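(* Let $(V,\omega)$ be a simple VOA of strong CFT type over $\mathbb{K}$. Then $\mathrm{Aut}\,V=\mathrm{Aut}^{-}V\,\mathrm{Aut}^{0}V\,\mathrm{Aut}^{+}V$. More precisely, for every $f\in\mathrm{Aut}\,V$ there exist unique elements $g\in\mathrm{Aut}^{-}V$, $h\in\mathrm{Aut}^{0}V$ and $k\in\mathrm{Aut}^{+}V$ such that $f=ghk$. In particular, if $J_1(V)=0$, then $\mathrm{Aut}\,V\cong\mathrm{Aut}^{+}V\rtimes\mathrm{Aut}^{0}V$.
   Context: The base field $\mathbb{K}$ is $\mathbb{R}$ or $\mathbb{C}$. For a vertex algebra $V$ over $\mathbb{K}$ with vacuum vector $\mathbf{1}$, $a(n)b$ denotes the $n$-th product ($n\in\mathbb{Z}$), $a(n)\in\mathrm{End}\,V$, and $Ta=a(-2)\mathbf{1}$. A $\mathbb{Z}$-graded vertex algebra is a vertex algebra $V=\bigoplus_{n\in\mathbb{Z}}V_n$ with $V_n(k)V_m\subset V_{n+m-k-1}$ and $\mathbf{1}\in V_0$. A $\mathbb{Z}$-graded conformal vertex algebra $(V,\omega)$ is a $\mathbb{Z}$-graded vertex algebra with a distinguished $\omega\in V_2$ such that the operators $L(n)=\omega(n+1)$ satisfy $[L(n),L(m)]=(n-m)L(n+m)+\frac{1}{12}\delta_{n+m,0}(n^3-n)c$ for some $c\in\mathbb{K}$, $L(0)v=nv$ for $v\in V_n$, and $L(-1)=T$. It is a VOA of CFT type if $V=\bigoplus_{n\in\mathbb{N}}V_n$ (with $\mathbb{N}=\{0,1,2,\dots\}$),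 $\dim V_n<\infty$ for all $n$, and $V_0=\mathbb{K}\mathbf{1}$. It is a VOA of strong CFT type if moreover $L(1)V_1=0$. Simple means that $V$ has no nontrivial proper ideals. $\mathrm{Aut}\,V$ is the group of vertex algebra automorphisms of $V$: linear isomorphisms $f$ with $f(a(n)b)=f(a)(n)f(b)$ for all $a,b,n$ and $f(\mathbf{1})=\mathbf{1}$ (not required to fix $\omega$). Let $\mathrm{pr}_n:V\to V_n$ be the canonical projection. $\mathrm{Aut}^{+}V=\{f\in\mathrm{Aut}\,V\mid f(V_n)\subset\bigoplus_{k\ge n}V_k\text{ and }\mathrm{pr}_n\circ f|_{V_n}=\mathrm{id}_{V_n}\text{ for all }n\}$; $\mathrm{Aut}^{-}V=\{f\in\mathrm{Aut}\,V\mid f(V_n)\subset\bigoplus_{k\le n}V_k\text{ and }\mathrm{pr}_n\circ f|_{V_n}=\mathrm{id}_{V_n}\text{ for all }n\}$; $\mathrm{Aut}^{0}V=\{f\in\mathrm{Aut}\,V\mid f(V_n)=V_n\text{ for all }n\}$; $J_1(V)=\{a\in V_1\mid a(0)=0\}$. *)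

theory Defs
  imports Complex_Main "HOL-Library.Groups_Big_Fun" "HOL-Algebra.Coset" "HOL-Algebra.Bij"
begin

section \<open>The base field\<close>

definition field_iso :: "('k::field_char_0 \<Rightarrow> 'l::field_char_0) \<Rightarrow> bool"
  where "field_iso \<phi> \<longleftrightarrow> bij \<phi> \<and> \<phi> 1 = 1 \<and>
    (\<forall>x y. \<phi> (x + y) = \<phi> x + \<phi> y) \<and> (\<forall>x y. \<phi> (x * y) = \<phi> x * \<phi> y)"

text \<open>The base field is a type \<open>'k\<close> that is (a copy of) the real or the complex numbers.\<close>

definition real_or_complex_field :: "'k::field_char_0 itself \<Rightarrow> bool"
  where "real_or_complex_field _ \<longleftrightarrow>
    (\<exists>\<phi> :: 'k \<Rightarrow> real. field_iso \<phi>) \<or> (\<exists>\<phi> :: 'k \<Rightarrow> complex. field_iso \<phi>)"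


section \<open>Vertex algebras\<close>

text \<open>
  \<open>nprod a n b\<close> is the \<open>n\<close>-th product \<open>a(n)b\<close>, and \<open>vac\<close> is the vacuum vector. The last axiom is
  the Borcherds identity
  \[\sum_{i \ge 0} {p \choose i} (a(r+i)b)(p+q-i)c =
    \sum_{i \ge 0} (-1)^i {r \choose i} (a(p+r-i)(b(q+i)c) - (-1)^r b(q+r-i)(a(p+i)c)).\]
  By the truncation axiom only finitely many terms of each sum are nonzero, so that \<open>Sum_any\<close>
  (which is \<open>0\<close> for infinite support) is the actual sum.
\<close>

locale vertex_algebra = vector_space scale
  for scale :: "'k::field_char_0 \<Rightarrow> 'v::ab_group_add \<Rightarrow> 'v" +
  fixes nprod :: "'v \<Rightarrow> int \<Rightarrow> 'v \<Rightarrow> 'v"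
    and vac :: 'v
  assumes linear_left: "Vector_Spaces.linear scale scale (\<lambda>a. nprod a n b)"
    and linear_right: "Vector_Spaces.linear scale scale (nprod a n)"
    and truncation: "\<exists>N. \<forall>n\<ge>N. nprod a n b = 0"
    and vacuum: "nprod vac n a = (if n = -1 then a else 0)"
    and creation: "nprod a (-1) vac = a"
    and creation_nonneg: "n \<ge> 0 \<Longrightarrow> nprod a n vac = 0"
    and Borcherds: "Sum_any (\<lambda>i::nat. scale (of_int p gchoose i)
          (nprod (nprod a (r + int i) b) (p + q - int i) c)) =
       Sum_any (\<lambda>i::nat. scale ((-1) ^ i * (of_int r gchoose i))
          (nprod a (p + r - int i) (nprod b (q + int i) c)
           - scale ((-1) powi r) (nprod b (q + r - int i) (nprod a (p + int i) c))))"


subsection \<open>Gradings\<close>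

definition is_decomposition :: "(int \<Rightarrow> 'v::ab_group_add set) \<Rightarrow> 'v \<Rightarrow> (int \<Rightarrow> 'v) \<Rightarrow> bool"
  where "is_decomposition gr v x \<longleftrightarrow>
    (\<forall>n. x n \<in> gr n) \<and> finite {n. x n \<noteq> 0} \<and> v = Sum_any x"

definition grading_proj :: "(int \<Rightarrow> 'v::ab_group_add set) \<Rightarrow> int \<Rightarrow> 'v \<Rightarrow> 'v"
  where "grading_proj gr n v = (THE x. is_decomposition gr v x) n"

locale graded_vertex_algebra = vertex_algebra scale nprod vac
  for scale :: "'k::field_char_0 \<Rightarrow> 'v::ab_group_add \<Rightarrow> 'v" and nprod vac +
  fixes gr :: "int \<Rightarrow> 'v set"
  assumes subspace_gr: "subspace (gr n)"
    and direct_sum: "\<exists>!x. is_decomposition gr v x"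
    and nprod_gr: "\<lbrakk>a \<in> gr n; b \<in> gr m\<rbrakk> \<Longrightarrow> nprod a k b \<in> gr (n + m - k - 1)"
    and vac_gr: "vac \<in> gr 0"

locale conformal_vertex_algebra = graded_vertex_algebra scale nprod vac gr
  for scale :: "'k::field_char_0 \<Rightarrow> 'v::ab_group_add \<Rightarrow> 'v" and nprod vac gr +
  fixes \<omega> :: 'v
  assumes omega_gr: "\<omega> \<in> gr 2"
    and Virasoro: "\<exists>c. \<forall>n m v.
      nprod \<omega> (n + 1) (nprod \<omega> (m + 1) v) - nprod \<omega> (m + 1) (nprod \<omega> (n + 1) v) =
        scale (of_int (n - m)) (nprod \<omega> (n + m + 1) v)
        + scale (1 / 12 * (if n + m = 0 then 1 else 0) * of_int (n ^ 3 - n) * c) v"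
    and L_0: "v \<in> gr n \<Longrightarrow> nprod \<omega> 1 v = scale (of_int n) v"
    and L_minus_1: "nprod \<omega> 0 v = nprod v (-2) vac"

locale CFT_type_VOA = conformal_vertex_algebra scale nprod vac gr \<omega>
  for scale :: "'k::field_char_0 \<Rightarrow> 'v::ab_group_add \<Rightarrow> 'v" and nprod vac gr \<omega> +
  assumes gr_neg: "n < 0 \<Longrightarrow> gr n = {0}"
    and finite_dim_gr: "\<exists>B. finite B \<and> gr n = span B"
    and gr_0: "gr 0 = span {vac}"

locale strong_CFT_type_VOA = CFT_type_VOA scale nprod vac gr \<omega>
  for scale :: "'k::field_char_0 \<Rightarrow> 'v::ab_group_add \<Rightarrow> 'v" and nprod vac gr \<omega> +
  assumes L_1: "v \<in> gr 1 \<Longrightarrow> nprod \<omega> 2 v = 0"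


subsection \<open>Simplicity\<close>

definition VA_ideal ::
    "('k::field_char_0 \<Rightarrow> 'v::ab_group_add \<Rightarrow> 'v) \<Rightarrow> ('v \<Rightarrow> int \<Rightarrow> 'v \<Rightarrow> 'v) \<Rightarrow> 'v set \<Rightarrow> bool"
  where "VA_ideal scale nprod I \<longleftrightarrow> module.subspace scale I \<and>
    (\<forall>a. \<forall>x\<in>I. \<forall>n. nprod a n x \<in> I \<and> nprod x n a \<in> I)"

definition VA_simple ::
    "('k::field_char_0 \<Rightarrow> 'v::ab_group_add \<Rightarrow> 'v) \<Rightarrow> ('v \<Rightarrow> int \<Rightarrow> 'v \<Rightarrow> 'v) \<Rightarrow> bool"
  where "VA_simple scale nprod \<longleftrightarrow> (\<forall>I. VA_ideal scale nprod I \<longrightarrow> I = {0} \<or> I = UNIV)"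


section \<open>Automorphisms\<close>

definition Aut ::
    "('k::field_char_0 \<Rightarrow> 'v::ab_group_add \<Rightarrow> 'v) \<Rightarrow> ('v \<Rightarrow> int \<Rightarrow> 'v \<Rightarrow> 'v) \<Rightarrow> 'v \<Rightarrow> ('v \<Rightarrow> 'v) set"
  where "Aut scale nprod vac = {f. Vector_Spaces.linear scale scale f \<and> bij f \<and>
    (\<forall>a b n. f (nprod a n b) = nprod (f a) n (f b)) \<and> f vac = vac}"

definition Aut_group ::
    "('k::field_char_0 \<Rightarrow> 'v::ab_group_add \<Rightarrow> 'v) \<Rightarrow> ('v \<Rightarrow> int \<Rightarrow> 'v \<Rightarrow> 'v) \<Rightarrow> 'v \<Rightarrow> ('v \<Rightarrow> 'v) monoid"
  where "Aut_group scale nprod vac = \<lparr>carrier = Aut scale nprod vac, mult = (\<circ>), one = id\<rparr>"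

definition Aut_plus where
  "Aut_plus scale nprod vac gr = {f \<in> Aut scale nprod vac.
    \<forall>n. f ` gr n \<subseteq> module.span scale (\<Union>k\<in>{n..}. gr k) \<and> (\<forall>v\<in>gr n. grading_proj gr n (f v) = v)}"

definition Aut_minus where
  "Aut_minus scale nprod vac gr = {f \<in> Aut scale nprod vac.
    \<forall>n. f ` gr n \<subseteq> module.span scale (\<Union>k\<in>{..n}. gr k) \<and> (\<forall>v\<in>gr n. grading_proj gr n (f v) = v)}"

definition Aut_zero where
  "Aut_zero scale nprod vac gr = {f \<in> Aut scale nprod vac. \<forall>n. f ` gr n = gr n}"

definition J_1 :: "('v \<Rightarrow> int \<Rightarrow> 'v \<Rightarrow> 'v::ab_group_add) \<Rightarrow> (int \<Rightarrow> 'v set) \<Rightarrow> 'v set"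
  where "J_1 nprod gr = {a \<in> gr 1. \<forall>b. nprod a 0 b = 0}"


section \<open>Semidirect products\<close>

text \<open>The outer semidirect product \<open>N \<rtimes> H\<close> with respect to an action \<open>\<phi> \<in> hom H (AutoGroup N)\<close>.\<close>

definition semidirect_product ::
    "('a, 'm) monoid_scheme \<Rightarrow> ('b, 'n) monoid_scheme \<Rightarrow> ('b \<Rightarrow> 'a \<Rightarrow> 'a) \<Rightarrow> ('a \<times> 'b) monoid"
  where "semidirect_product N H \<phi> =
    \<lparr>carrier = carrier N \<times> carrier H,
     mult = (\<lambda>(n, h) (n', h'). (n \<otimes>\<^bsub>N\<^esub> \<phi> h n', h \<otimes>\<^bsub>H\<^esub> h')),
     one = (\<one>\<^bsub>N\<^esub>, \<one>\<^bsub>H\<^esub>)\<rparr>"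

definition conjugation_on :: "('a, 'm) monoid_scheme \<Rightarrow> 'a set \<Rightarrow> 'a \<Rightarrow> 'a \<Rightarrow> 'a"
  where "conjugation_on G N h = (\<lambda>x\<in>N. h \<otimes>\<^bsub>G\<^esub> x \<otimes>\<^bsub>G\<^esub> inv\<^bsub>G\<^esub> h)"

end

theory Submission
  imports Defs
begin

text \<open>
  Write \<open>T v = v(-2)\<one>\<close> and let \<open>f\<close> be an automorphism. It need not fix \<open>\<omega>\<close>, but \<open>\<omega>(0) = T\<close> is
  determined by the products, so every homogeneous component \<open>a\<close> of \<open>f \<omega> - \<omega>\<close> satisfies
  \<open>a(0) = 0\<close>, and then \<open>a(1)\<close> is a derivation.

  If \<open>a\<close> has weight one, this derivation lowers weights by one, so \<open>exp(a(1))\<close> lies in \<open>Aut\<^sup>- V\<close>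
  (\<open>exp_map_Aut_minus\<close>), and \<open>a(1)\<omega> = a\<close>. Composing \<open>f\<close> with the inverse of the exponential, one
  reaches an automorphism \<open>f'\<close> for which \<open>f' \<omega> - \<omega>\<close> has no component of weight one
  (\<open>remove_weight_one\<close>). If \<open>J\<^sub>1(V) = 0\<close>, the exponential is the identity.

  The operator \<open>f' L(0) f'\<inverse> = (f' \<omega>)(1)\<close> then is \<open>L(0) + E\<close> plus operators that raise weights, where
  \<open>E = c(1)\<close> for the component \<open>c\<close> of weight two. By induction on \<open>n\<close>, \<open>f'\<close> preserves
  \<open>\<Oplus>\<^sub>k\<^sub>\<ge>\<^sub>n V\<^sub>k\<close> and \<open>E\<close> vanishes on \<open>V\<^sub>k\<close> for \<open>k < n\<close> (\<open>Aut_preserves_upper\<close>). In the induction step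
  \<open>E\<close> is diagonalizable on \<open>V\<^sub>n\<close> with eigenvalues \<open>m - n \<ge> 0\<close>, because \<open>n + E\<close> is induced from the
  restriction of \<open>f' L(0) f'\<inverse>\<close> to the sum of the \<open>f'(V\<^sub>m)\<close> with \<open>m \<ge> n\<close>. An eigenvector \<open>w\<close> with
  positive eigenvalue is quasi-primary, since \<open>L(1)\<close> commutes with \<open>E\<close> and \<open>E\<close> vanishes in weight
  \<open>n - 1\<close>. Simplicity and \<open>L(1)V\<^sub>1 = 0\<close> give \<open>a \<in> V\<^sub>n\<close> with \<open>a(2n - 1)w\<close> a nonzero multiple of \<open>\<one>\<close>
  (\<open>quasi_primary_pairing\<close>), and \<open>a\<close> may be taken to be an eigenvector. As \<open>E \<one> = 0\<close>, the
  eigenvalues of \<open>a\<close> and \<open>w\<close> add up to \<open>0\<close>, which is impossible. Hence \<open>E = 0\<close> on \<open>V\<^sub>n\<close>, and the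
  finite dimension of \<open>V\<^sub>n\<close> shows that \<open>f'\<close> preserves the next step of the filtration exactly.

  The associated graded map \<open>h\<close> of \<open>f'\<close> lies in \<open>Aut\<^sup>0 V\<close> and \<open>h\<inverse> f'\<close> in \<open>Aut\<^sup>+ V\<close>
  (\<open>filtered_decomposition\<close>). Uniqueness compares lower and upper triangular maps
  (\<open>triangular_decomposition_unique\<close>), and the semidirect product is the one of a subgroup with a
  complement that normalizes it.
\<close>

section \<open>Consequences of the Borcherds identity\<close>

context vertex_algebra
begin

lemma nprod_add_left: "nprod (a + a') n b = nprod a n b + nprod a' n b"
  using linear_left[of n b] by (simp add: Vector_Spaces.linear_iff)

lemma nprod_scale_left: "nprod (scale c a) n b = scale c (nprod a n b)"
  using linear_left[of n b] by (simp add: Vector_Spaces.linear_iff)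

lemma nprod_add_right: "nprod a n (b + b') = nprod a n b + nprod a n b'"
  using linear_right[of a n] by (simp add: Vector_Spaces.linear_iff)

lemma nprod_scale_right: "nprod a n (scale c b) = scale c (nprod a n b)"
  using linear_right[of a n] by (simp add: Vector_Spaces.linear_iff)

lemma nprod_zero_left [simp]: "nprod 0 n b = 0"
  using nprod_add_left[of 0 0 n b] by simp

lemma nprod_zero_right [simp]: "nprod a n 0 = 0"
  using nprod_add_right[of a n 0 0] by simp

lemma nprod_minus_left: "nprod (- a) n b = - nprod a n b"
  using minus_unique[of "nprod a n b" "nprod (- a) n b"] nprod_add_left[of a "- a" n b] by simp

lemma nprod_minus_right: "nprod a n (- b) = - nprod a n b"
  using minus_unique[of "nprod a n b" "nprod a n (- b)"] nprod_add_right[of a n b "- b"] by simp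

lemma nprod_diff_left: "nprod (a - a') n b = nprod a n b - nprod a' n b"
  using nprod_add_left[of a "- a'" n b] by (simp add: nprod_minus_left)

lemma nprod_diff_right: "nprod a n (b - b') = nprod a n b - nprod a n b'"
  using nprod_add_right[of a n b "- b'"] by (simp add: nprod_minus_right)

lemma nprod_sum_left: "nprod (sum f A) n b = (\<Sum>i\<in>A. nprod (f i) n b)"
  by (induction A rule: infinite_finite_induct) (auto simp: nprod_add_left)

lemma nprod_sum_right: "nprod a n (sum f A) = (\<Sum>i\<in>A. nprod a n (f i))"
  by (induction A rule: infinite_finite_induct) (auto simp: nprod_add_right)

lemmas nprod_linear =
  nprod_add_left nprod_add_right nprod_scale_left nprod_scale_right
  nprod_diff_left nprod_diff_right nprod_minus_left nprod_minus_right

text \<open>The case \<open>r = 0\<close> of the Borcherds identity.\<close>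

lemma commutator:
  "nprod a (int p) (nprod b q c) - nprod b q (nprod a (int p) c) =
    (\<Sum>i\<le>p. scale (of_nat (p choose i)) (nprod (nprod a (int i) b) (int p + q - int i) c))"
proof -
  have L: "Sum_any (\<lambda>i::nat. scale (of_int (int p) gchoose i)
          (nprod (nprod a (0 + int i) b) (int p + q - int i) c)) =
    (\<Sum>i\<le>p. scale (of_nat (p choose i)) (nprod (nprod a (int i) b) (int p + q - int i) c))"
  proof (subst Sum_any.expand_superset[of "{..p}"])
    have "(of_int (int p) gchoose i :: 'k) = 0" if "i > p" for i
      using that by (simp add: binomial_gbinomial[symmetric])
    then show "{i. scale (of_int (int p) gchoose i)
          (nprod (nprod a (0 + int i) b) (int p + q - int i) c) \<noteq> 0} \<subseteq> {..p}"
      by (force simp: not_le[symmetric])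
  qed (auto simp: binomial_gbinomial)
  have R: "Sum_any (\<lambda>i::nat. scale ((-1) ^ i * (of_int 0 gchoose i))
          (nprod a (int p + 0 - int i) (nprod b (q + int i) c)
           - scale ((-1) powi 0) (nprod b (q + 0 - int i) (nprod a (int p + int i) c)))) =
      nprod a (int p) (nprod b q c) - nprod b q (nprod a (int p) c)"
    by (subst Sum_any.expand_superset[of "{0}"])
      (auto simp: gbinomial_0_left split: if_splits)
  show ?thesis
    using Borcherds[of "int p" a 0 b q c] L R by simp
qed

lemma commutator_1:
  "nprod a 1 (nprod b q c) - nprod b q (nprod a 1 c) =
    nprod (nprod a 0 b) (q + 1) c + nprod (nprod a 1 b) q c"
  using commutator[of a 1 b q c] by (simp add: add.commute)

lemma commutator_2:
  "nprod a 2 (nprod b q c) - nprod b q (nprod a 2 c) =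
    nprod (nprod a 0 b) (q + 2) c + scale 2 (nprod (nprod a 1 b) (q + 1) c)
    + nprod (nprod a 2 b) q c"
  using commutator[of a 2 b q c]
  by (simp add: numeral_2_eq_2 algebra_simps)

text \<open>The case \<open>p = 0\<close>, \<open>r = -2\<close>, \<open>b = \<one>\<close>: the rule \<open>(T a)(n) = -n a(n - 1)\<close>. On the right-hand side
  only the term with \<open>n + i = -1\<close> or the one with \<open>n - 2 - i = -1\<close> survives.\<close>

lemma nprod_translation:
  "nprod (nprod a (-2) vac) n c = scale (- of_int n) (nprod a (n - 1) c)"
proof -
  define F where "F = (\<lambda>i::nat. scale ((-1) ^ i * (of_int (-2) gchoose i))
          (nprod a (0 + -2 - int i) (nprod vac (n + int i) c)
           - scale ((-1) powi (-2)) (nprod vac (n + -2 - int i) (nprod a (0 + int i) c))))"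
  have L: "Sum_any (\<lambda>i::nat. scale (of_int 0 gchoose i)
          (nprod (nprod a (-2 + int i) vac) (0 + n - int i) c)) = nprod (nprod a (-2) vac) n c"
    by (subst Sum_any.expand_superset[of "{0}"])
      (auto simp: gbinomial_0_left split: if_splits)
  have coeff: "(-1) ^ i * ((-2) gchoose i) = (of_nat i + 1 :: 'k)" for i
  proof -
    have "((-2) gchoose i :: 'k) = (-1) ^ i * (of_nat (Suc i) gchoose i)"
      using gbinomial_minus[of "2 :: 'k" i] by (simp add: algebra_simps)
    also have "(of_nat (Suc i) gchoose i :: 'k) = of_nat (Suc i choose i)"
      by (rule binomial_gbinomial[symmetric])
    also have "Suc i choose i = Suc i"
      using binomial_symmetric[of i "Suc i"] by simp
    finally show ?thesis
      by (simp add: algebra_simps flip: power_add)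
  qed
  have F: "F i = scale (of_nat i + 1) ((if n + int i = -1 then nprod a (-2 - int i) c else 0)
        - (if n - 2 - int i = -1 then nprod a (int i) c else 0))" for i
    unfolding F_def using coeff[of i] by (auto simp: vacuum power_int_minus)
  have "Sum_any F = scale (- of_int n) (nprod a (n - 1) c)"
  proof (cases "n = 0")
    case True
    then have "F = (\<lambda>i. 0)"
      using F by auto
    then show ?thesis
      using True by simp
  next
    case False
    define i0 where "i0 = (if n < 0 then nat (- n - 1) else nat (n - 1))"
    have "{i. F i \<noteq> 0} \<subseteq> {i0}"
      unfolding F i0_def by (auto split: if_splits)
    then have "Sum_any F = F i0"
      by (subst Sum_any.expand_superset[of "{i0}"]) auto
    also have "\<dots> = scale (- of_int n) (nprod a (n - 1) c)"
      unfolding F i0_def using False by (auto simp: algebra_simps of_nat_nat scale_minus_left)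
    finally show ?thesis .
  qed
  then show ?thesis
    using Borcherds[of 0 a "-2" vac n c] L unfolding F_def by simp
qed

text \<open>The case \<open>p = -1\<close>, \<open>q = 0\<close>, \<open>c = \<one>\<close>. The bound \<open>N\<close> comes from truncation.\<close>

lemma skew_symmetry:
  assumes "\<And>i. i \<ge> N \<Longrightarrow> nprod a (r + int i) b = 0"
  shows "nprod b r a = scale (- ((-1) powi r))
    (\<Sum>i<N. scale ((-1) ^ i) (nprod (nprod a (r + int i) b) (-1 - int i) vac))"
proof -
  have m1: "((-1) gchoose i) = ((-1) ^ i :: 'k)" for i
    using gbinomial_minus[of "1 :: 'k" i] by (simp add: binomial_gbinomial[symmetric])
  have L: "Sum_any (\<lambda>i::nat. scale (of_int (-1) gchoose i)
          (nprod (nprod a (r + int i) b) (-1 + 0 - int i) vac)) =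
      (\<Sum>i<N. scale ((-1) ^ i) (nprod (nprod a (r + int i) b) (-1 - int i) vac))"
  proof (subst Sum_any.expand_superset[of "{..<N}"])
    show "{i. scale (of_int (-1) gchoose i)
          (nprod (nprod a (r + int i) b) (-1 + 0 - int i) vac) \<noteq> 0} \<subseteq> {..<N}"
    proof
      fix i assume "i \<in> {i. scale (of_int (-1) gchoose i)
          (nprod (nprod a (r + int i) b) (-1 + 0 - int i) vac) \<noteq> 0}"
      then have "\<not> i \<ge> N"
        using assms[of i] by auto
      then show "i \<in> {..<N}"
        by simp
    qed
  qed (auto simp: m1)
  have vac0: "nprod a (int i - 1) vac = (if i = 0 then a else 0)" for i
    by (auto intro: creation_nonneg simp: creation)
  have "Sum_any (\<lambda>i::nat. scale ((-1) ^ i * (of_int r gchoose i))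
          (nprod a (-1 + r - int i) (nprod b (0 + int i) vac)
           - scale ((-1) powi r) (nprod b (0 + r - int i) (nprod a (-1 + int i) vac)))) =
      scale (- ((-1) powi r)) (nprod b r a)"
    by (subst Sum_any.expand_superset[of "{0}"])
      (auto simp: vac0 creation creation_nonneg split: if_splits)
  with L Borcherds[of "-1" a r b 0 vac]
  have "scale (- ((-1) powi r)) (nprod b r a) =
      (\<Sum>i<N. scale ((-1) ^ i) (nprod (nprod a (r + int i) b) (-1 - int i) vac))"
    by simp
  moreover have "(- ((-1) powi r)) * (- ((-1) powi r)) = (1 :: 'k)"
    using power_int_mult_distrib[of "-1 :: 'k" "-1" r] by simp
  ultimately show ?thesis
    by (metis scale_one scale_scale)
qed

text \<open>Up to a scalar, \<open>x(-1 - i)\<one>\<close> is the \<open>i\<close>-th divided power of the translation operator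
  \<open>T x = x(-2)\<one>\<close>.\<close>

lemma nprod_vac_Suc:
  "nprod x (-1 - int (Suc i)) vac =
    scale (1 / of_nat (Suc i)) (nprod (nprod x (-2) vac) (-1 - int i) vac)"
proof -
  have "nprod (nprod x (-2) vac) (-1 - int i) vac =
      scale (of_nat (Suc i)) (nprod x (-1 - int (Suc i)) vac)"
    by (subst nprod_translation) (simp add: algebra_simps)
  then show ?thesis
    using of_nat_neq_0[of i, where 'a = 'k] by simp
qed

lemma nprod_vac_range_TT:
  "nprod x (-1 - int (Suc (Suc i))) vac \<in> (\<lambda>y. nprod (nprod y (-2) vac) (-2) vac) ` UNIV"
proof (induction i arbitrary: x)
  case 0
  show ?case
    using nprod_vac_Suc[of x 1]
    by (auto simp: nprod_scale_left intro!: image_eqI[of _ _ "scale (1 / 2) x"])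
next
  case (Suc i)
  then obtain y where
    "nprod (nprod x (-2) vac) (-1 - int (Suc (Suc i))) vac = nprod (nprod y (-2) vac) (-2) vac"
    by blast
  then show ?case
    by (subst nprod_vac_Suc) (auto simp: nprod_scale_left
        intro!: image_eqI[of _ _ "scale (1 / of_nat (Suc (Suc (Suc i)))) y"])
qed

subsection \<open>Derivations from zero modes that vanish\<close>

text \<open>If \<open>a(0) = 0\<close>, then \<open>a(1)\<close> is a derivation of all products, because only the term of
  \<open>a(1)b\<close> survives in the commutator formula for \<open>a(1)\<close>.\<close>

lemma first_mode_derivation:
  assumes "\<And>b. nprod a 0 b = 0"
  shows "nprod a 1 (nprod b n c) = nprod (nprod a 1 b) n c + nprod b n (nprod a 1 c)"
  using commutator_1[of a b n c] assms by (simp add: algebra_simps)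

subsection \<open>The ideal generated by a vector\<close>

text \<open>The Borcherds identity expresses \<open>a(p)(b(q)v)\<close> through \<open>(a(i)b)(j)v\<close> and \<open>a(p')(b(q')v)\<close>
  with \<open>q' > q\<close>; since \<open>b(q')v = 0\<close> for large \<open>q'\<close>, induction on \<open>q\<close> applies.\<close>

lemma modes_span_left_closed:
  "nprod a p (nprod b q v) \<in> span {nprod a k v |a k. True}"
proof -
  let ?J = "span {nprod a k v |a k. True}"
  obtain M where M: "\<And>n. n \<ge> M \<Longrightarrow> nprod b n v = 0"
    using truncation by metis
  obtain N where N: "\<And>n. n \<ge> N \<Longrightarrow> nprod a n v = 0"
    using truncation by metis
  have mem: "nprod x k v \<in> ?J" for x k
    by (rule span_base) auto
  show ?thesis
  proof (induction "nat (M - q)" arbitrary: p q rule: less_induct)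
    case less
    show ?case
    proof (cases "q \<ge> M")
      case True
      then show ?thesis
        by (simp add: M span_zero)
    next
      case False
      define F where "F = (\<lambda>i::nat. scale ((-1) ^ i * (of_int (p - N) gchoose i))
          (nprod a (N + (p - N) - int i) (nprod b (q + int i) v)
           - scale ((-1) powi (p - N)) (nprod b (q + (p - N) - int i) (nprod a (N + int i) v))))"
      have F: "F i = scale ((-1) ^ i * (of_int (p - N) gchoose i))
          (nprod a (p - int i) (nprod b (q + int i) v))" for i
        unfolding F_def by (simp add: N)
      have fin: "{i. F i \<noteq> 0} \<subseteq> {..nat (M - q)}"
      proof
        fix i assume "i \<in> {i. F i \<noteq> 0}"
        then have "\<not> q + int i \<ge> M"
          using F M by auto
        then show "i \<in> {..nat (M - q)}"
          by auto
      qed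
      have "Sum_any F \<in> ?J"
        unfolding F_def Borcherds[of N a "p - N" b q v, symmetric]
        unfolding Sum_any.expand_set by (intro span_sum span_scale mem)
      also have "Sum_any F = (\<Sum>i\<le>nat (M - q). F i)"
        by (rule Sum_any.expand_superset) (use fin in auto)
      also have "\<dots> = F 0 + (\<Sum>i\<in>{1..nat (M - q)}. F i)"
        by (subst sum.remove[of _ 0]) (auto intro!: sum.cong)
      finally have "F 0 + (\<Sum>i\<in>{1..nat (M - q)}. F i) \<in> ?J" .
      moreover have "(\<Sum>i\<in>{1..nat (M - q)}. F i) \<in> ?J"
        unfolding F using False by (intro span_sum span_scale less) auto
      ultimately have "F 0 \<in> ?J"
        using span_diff by fastforce
      then show ?thesis
        by (simp add: F)
    qed
  qed
qed

end

context conformal_vertex_algebra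
begin

lemma modes_span_ideal:
  "VA_ideal scale nprod (span {nprod a k v |a k. True})"
proof -
  let ?J = "span {nprod a k v |a k. True}"
  have left: "nprod a n x \<in> ?J" if "x \<in> ?J" for a n x
    using that
  proof (induction rule: span_induct_alt)
    case base
    then show ?case by (simp add: span_zero)
  next
    case (step c x y)
    then show ?case
      using modes_span_left_closed
      by (auto simp: nprod_linear intro!: span_add span_scale)
  qed
  have vac: "nprod x (-1 - int i) vac \<in> ?J" if "x \<in> ?J" for x i
    using that
  proof (induction i arbitrary: x)
    case 0
    then show ?case by (simp add: creation)
  next
    case (Suc i)
    have "nprod x (-2) vac \<in> ?J"
      using left[OF Suc.prems] by (simp flip: L_minus_1)
    then show ?case
      by (subst nprod_vac_Suc) (intro span_scale Suc.IH)
  qed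
  have right: "nprod x n a \<in> ?J" if "x \<in> ?J" for a n x
  proof -
    obtain M where M: "\<And>k. k \<ge> M \<Longrightarrow> nprod a k x = 0"
      using truncation by metis
    have "nprod a (n + int i) x = 0" if "i \<ge> nat (M - n)" for i
      using that by (intro M) linarith
    then show ?thesis
      by (subst skew_symmetry[of "nat (M - n)" a n x])
        (simp, intro span_scale span_sum vac left that)
  qed
  show ?thesis
    unfolding VA_ideal_def using left right subspace_span by blast
qed

end

section \<open>Homogeneous components and the two filtrations\<close>

context graded_vertex_algebra
begin

abbreviation pr :: "int \<Rightarrow> 'v \<Rightarrow> 'v"
  where "pr n v \<equiv> grading_proj gr n v"

lemma is_decomposition_pr: "is_decomposition gr v (\<lambda>n. pr n v)"
  using theI'[OF direct_sum[of v]] unfolding grading_proj_def by simp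

lemma pr_mem [simp]: "pr n v \<in> gr n"
  using is_decomposition_pr[of v] by (simp add: is_decomposition_def)

lemma finite_pr: "finite {n. pr n v \<noteq> 0}"
  using is_decomposition_pr[of v] by (simp add: is_decomposition_def)

lemma Sum_any_pr: "Sum_any (\<lambda>n. pr n v) = v"
  using is_decomposition_pr[of v] by (simp add: is_decomposition_def)

lemma sum_pr: "finite S \<Longrightarrow> {n. pr n v \<noteq> 0} \<subseteq> S \<Longrightarrow> (\<Sum>n\<in>S. pr n v) = v"
  using Sum_any.expand_superset[of S "\<lambda>n. pr n v"] Sum_any_pr[of v] by simp

lemma pr_unique: "is_decomposition gr v x \<Longrightarrow> pr n v = x n"
  using direct_sum[of v] is_decomposition_pr[of v] by metis

lemma zero_gr [simp]: "0 \<in> gr n"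
  using subspace_gr by (rule subspace_0)

lemma pr_add: "pr n (u + v) = pr n u + pr n v"
proof (rule pr_unique)
  have "finite {n. pr n u + pr n v \<noteq> 0}"
    by (rule finite_subset[OF _ finite_UnI[OF finite_pr[of u] finite_pr[of v]]]) auto
  then show "is_decomposition gr (u + v) (\<lambda>n. pr n u + pr n v)"
    using Sum_any.distrib[OF finite_pr[of u] finite_pr[of v]]
    by (auto simp: is_decomposition_def Sum_any_pr intro: subspace_add[OF subspace_gr])
qed

lemma pr_same: "v \<in> gr n \<Longrightarrow> pr m v = (if m = n then v else 0)"
  by (rule pr_unique) (auto simp: is_decomposition_def)

lemma pr_zero [simp]: "pr n 0 = 0"
  using pr_same[of 0 n n] by simp

lemma pr_scale: "pr n (scale c v) = scale c (pr n v)"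
proof (rule pr_unique)
  have fin: "finite {n. scale c (pr n v) \<noteq> 0}"
    by (rule finite_subset[OF _ finite_pr[of v]]) auto
  have "Sum_any (\<lambda>n. scale c (pr n v)) = (\<Sum>n | pr n v \<noteq> 0. scale c (pr n v))"
    by (rule Sum_any.expand_superset) (auto simp: finite_pr)
  also have "\<dots> = scale c v"
    using sum_pr[OF finite_pr order.refl, of v] by (simp flip: scale_sum_right)
  finally show "is_decomposition gr (scale c v) (\<lambda>n. scale c (pr n v))"
    using fin by (auto simp: is_decomposition_def intro: subspace_scale[OF subspace_gr])
qed

lemma pr_minus: "pr n (- v) = - pr n v"
  using minus_unique[of "pr n v" "pr n (- v)"] pr_add[of n v "- v"] by simp

lemma pr_diff: "pr n (u - v) = pr n u - pr n v"
  using pr_add[of n u "- v"] by (simp add: pr_minus)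

lemma pr_sum: "pr n (sum f A) = (\<Sum>i\<in>A. pr n (f i))"
  by (induction A rule: infinite_finite_induct) (auto simp: pr_add)

lemma pr_eqI:
  assumes "\<And>n. pr n u = pr n v"
  shows "u = v"
proof -
  have "(\<lambda>n. pr n u) = (\<lambda>n. pr n v)"
    using assms by (rule ext)
  then show ?thesis
    using Sum_any_pr[of u] Sum_any_pr[of v] by metis
qed

lemma pr_pr: "pr m (pr n v) = (if m = n then pr n v else 0)"
  by (rule pr_same) simp

lemma mem_gr_iff: "v \<in> gr n \<longleftrightarrow> (\<forall>m. m \<noteq> n \<longrightarrow> pr m v = 0)"
proof
  assume *: "\<forall>m. m \<noteq> n \<longrightarrow> pr m v = 0"
  have "v = pr n v"
    by (rule pr_eqI) (use * in \<open>auto simp: pr_pr\<close>)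
  then show "v \<in> gr n"
    by (metis pr_mem)
qed (auto simp: pr_same)

text \<open>Additive statements need only be checked on homogeneous vectors.\<close>

lemma homogeneous_induct:
  assumes "\<And>n v. v \<in> gr n \<Longrightarrow> P v" and "\<And>u v. P u \<Longrightarrow> P v \<Longrightarrow> P (u + v)"
  shows "P v"
proof -
  have "P (\<Sum>n\<in>S. pr n v)" if "finite S" for S
    using that
  proof (induction S rule: finite_induct)
    case empty
    then show ?case using assms(1)[of 0 0] by simp
  next
    case (insert n S)
    then show ?case using assms(1)[OF pr_mem, of n v] assms(2) by simp
  qed
  then show ?thesis
    using finite_pr[of v] sum_pr[OF finite_pr order.refl, of v] by metis
qed

lemma pr_shift:
  assumes "\<And>u v. X (u + v) = X u + X v" and "\<And>m v. v \<in> gr m \<Longrightarrow> X v \<in> gr (m + d)"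
  shows "pr k (X v) = X (pr (k - d) v)"
proof (induction v rule: homogeneous_induct)
  case (1 n v)
  have "X 0 = 0"
    using assms(1)[of 0 0] by simp
  then show ?case
    using assms(2)[OF 1] 1 by (auto simp: pr_same)
qed (simp add: pr_add assms(1))

lemma pr_nprod_left: "a \<in> gr n \<Longrightarrow> pr l (nprod a k b) = nprod a k (pr (l - (n - k - 1)) b)"
  by (rule pr_shift) (auto simp: nprod_linear algebra_simps dest: nprod_gr[of a n _ _ k])

lemma pr_nprod_right: "b \<in> gr m \<Longrightarrow> pr l (nprod a k b) = nprod (pr (l - (m - k - 1)) a) k b"
  by (rule pr_shift[of "\<lambda>a. nprod a k b"])
    (auto simp: nprod_linear algebra_simps dest: nprod_gr[of _ _ b m k])

lemma additive_sum:
  assumes "\<And>u v. X (u + v) = X u + (X v :: 'v)"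
  shows "X (sum f A) = (\<Sum>i\<in>A. X (f i :: 'v))"
proof -
  have "X 0 = 0"
    using assms[of 0 0] by simp
  then show ?thesis
    by (induction A rule: infinite_finite_induct) (auto simp: assms)
qed

lemma additive_components:
  assumes "\<And>u v. X (u + v) = X u + (X v :: 'v)"
  shows "X v = (\<Sum>i | pr i v \<noteq> 0. X (pr i v))"
  using additive_sum[of X "\<lambda>i. pr i v", OF assms] sum_pr[OF finite_pr order.refl, of v] by metis

text \<open>The decreasing filtration \<open>upper n = \<Oplus>\<^sub>k\<^sub>\<ge>\<^sub>n V\<^sub>k\<close> and the increasing filtration
  \<open>lower n = \<Oplus>\<^sub>k\<^sub>\<le>\<^sub>n V\<^sub>k\<close>, described through homogeneous components.\<close>

definition upper :: "int \<Rightarrow> 'v set"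
  where "upper n = {v. \<forall>k<n. pr k v = 0}"

definition lower :: "int \<Rightarrow> 'v set"
  where "lower n = {v. \<forall>k>n. pr k v = 0}"

lemma subspace_upper: "subspace (upper n)"
  by (auto simp: upper_def subspace_def pr_add pr_scale)

lemma subspace_lower: "subspace (lower n)"
  by (auto simp: lower_def subspace_def pr_add pr_scale)

lemma span_gr: "span (\<Union>k\<in>S. gr k) = {v. \<forall>k. k \<notin> S \<longrightarrow> pr k v = 0}"
proof
  have "subspace {v. \<forall>k. k \<notin> S \<longrightarrow> pr k v = 0}"
    by (auto simp: subspace_def pr_add pr_scale)
  then show "span (\<Union>k\<in>S. gr k) \<subseteq> {v. \<forall>k. k \<notin> S \<longrightarrow> pr k v = 0}"
    by (intro span_minimal) (auto simp: pr_same)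
  show "{v. \<forall>k. k \<notin> S \<longrightarrow> pr k v = 0} \<subseteq> span (\<Union>k\<in>S. gr k)"
  proof
    fix v assume "v \<in> {v. \<forall>k. k \<notin> S \<longrightarrow> pr k v = 0}"
    then have "(\<Sum>k | pr k v \<noteq> 0. pr k v) \<in> span (\<Union>k\<in>S. gr k)"
      by (intro span_sum span_base) (use pr_mem in blast)
    then show "v \<in> span (\<Union>k\<in>S. gr k)"
      using sum_pr[OF finite_pr order.refl, of v] by simp
  qed
qed

lemma span_upper: "span (\<Union>k\<in>{n..}. gr k) = upper n"
  unfolding span_gr upper_def by (auto simp: not_le)

lemma span_lower: "span (\<Union>k\<in>{..n}. gr k) = lower n"
  unfolding span_gr lower_def by (auto simp: not_le)

lemma gr_upper: "v \<in> gr n \<Longrightarrow> v \<in> upper n"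
  by (auto simp: upper_def pr_same)

lemma gr_lower: "v \<in> gr n \<Longrightarrow> v \<in> lower n"
  by (auto simp: lower_def pr_same)

lemma upper_mono: "m \<le> n \<Longrightarrow> upper n \<subseteq> upper m"
  by (auto simp: upper_def)

lemma lower_mono: "m \<le> n \<Longrightarrow> lower m \<subseteq> lower n"
  by (auto simp: lower_def)

lemma upper_Suc: "v \<in> upper n \<Longrightarrow> pr n v = 0 \<Longrightarrow> v \<in> upper (n + 1)"
  unfolding upper_def by (auto simp: order.order_iff_strict)

lemma upper_minus_pr: "v \<in> upper n \<Longrightarrow> v - pr n v \<in> upper (n + 1)"
  unfolding upper_def by (auto simp: pr_diff pr_pr)

lemma lower_minus_pr: "v \<in> lower n \<Longrightarrow> v - pr n v \<in> lower (n - 1)"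
  unfolding lower_def by (auto simp: pr_diff pr_pr)

lemma ex_lower: "\<exists>n. v \<in> lower n"
proof (cases "{n. pr n v \<noteq> 0} = {}")
  case False
  then have "v \<in> lower (Max {n. pr n v \<noteq> 0})"
    using Max_ge[OF finite_pr] by (force simp: lower_def)
  then show ?thesis ..
qed (auto simp: lower_def)

lemma nonzero_leading:
  assumes "v \<noteq> 0"
  obtains n where "v \<in> upper n" "pr n v \<noteq> 0"
proof -
  have "{n. pr n v \<noteq> 0} \<noteq> {}"
    using assms pr_eqI[of v 0] by auto
  then have "v \<in> upper (Min {n. pr n v \<noteq> 0})" "pr (Min {n. pr n v \<noteq> 0}) v \<noteq> 0"
    using Min_le[OF finite_pr, of _ v] Min_in[OF finite_pr, of v] by (force simp: upper_def)+
  then show ?thesis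
    by (rule that)
qed

lemma nonzero_top:
  assumes "v \<noteq> 0"
  obtains n where "v \<in> lower n" "pr n v \<noteq> 0"
proof -
  have "{n. pr n v \<noteq> 0} \<noteq> {}"
    using assms pr_eqI[of v 0] by auto
  then have "v \<in> lower (Max {n. pr n v \<noteq> 0})" "pr (Max {n. pr n v \<noteq> 0}) v \<noteq> 0"
    using Max_ge[OF finite_pr, of _ v] Max_in[OF finite_pr, of v] by (force simp: lower_def)+
  then show ?thesis
    by (rule that)
qed

lemma pr_nprod:
  "pr l (nprod x k y) = (\<Sum>i | pr i x \<noteq> 0. nprod (pr i x) k (pr (l - (i - k - 1)) y))"
  using additive_components[of "\<lambda>x. pr l (nprod x k y)" x]
  by (simp add: nprod_linear pr_add pr_nprod_left[OF pr_mem])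

lemma pr_nprod_upper:
  assumes "x \<in> upper n" "y \<in> upper m"
  shows "pr (n + m - k - 1) (nprod x k y) = nprod (pr n x) k (pr m y)"
proof -
  have ge: "n \<le> i" if "pr i x \<noteq> 0" for i
    using assms(1) that by (auto simp: upper_def not_less[symmetric])
  have "pr (n + m - k - 1) (nprod x k y) =
      (\<Sum>i | pr i x \<noteq> 0. if i = n then nprod (pr n x) k (pr m y) else 0)"
    unfolding pr_nprod
  proof (rule sum.cong[OF refl])
    fix i assume "i \<in> {i. pr i x \<noteq> 0}"
    then have "n \<le> i"
      using ge by simp
    then show "nprod (pr i x) k (pr (n + m - k - 1 - (i - k - 1)) y) =
        (if i = n then nprod (pr n x) k (pr m y) else 0)"
      using assms(2) by (auto simp: upper_def)
  qed
  then show "pr (n + m - k - 1) (nprod x k y) = nprod (pr n x) k (pr m y)"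
    using finite_pr[of x] by auto
qed

subsection \<open>Triangular maps\<close>

lemma upper_map:
  assumes add: "\<And>u v. X (u + v) = X u + (X v :: 'v)"
    and X: "\<And>m v. v \<in> gr m \<Longrightarrow> X v \<in> upper m"
    and v: "v \<in> upper n"
  shows "X v \<in> upper n \<and> pr n (X v) = pr n (X (pr n v))"
proof -
  have X0: "X 0 = 0"
    using add[of 0 0] by simp
  have E: "pr k (X v) = (\<Sum>i | pr i v \<noteq> 0. pr k (X (pr i v)))" for k
    using additive_components[of "\<lambda>v. pr k (X v)" v] by (simp add: add pr_add)
  have ge: "n \<le> i" if "pr i v \<noteq> 0" for i
    using v that by (auto simp: upper_def not_less[symmetric])
  have zero: "pr k (X (pr i v)) = 0" if "k < i" for k i
    using X[OF pr_mem[of i v]] that by (simp add: upper_def)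
  have "pr k (X v) = 0" if "k < n" for k
    unfolding E using ge zero order.strict_trans2[OF that] by (intro sum.neutral) blast
  moreover have "pr n (X v) = (\<Sum>i | pr i v \<noteq> 0. if i = n then pr n (X (pr n v)) else 0)"
    unfolding E
  proof (rule sum.cong[OF refl])
    fix i assume "i \<in> {i. pr i v \<noteq> 0}"
    then show "pr n (X (pr i v)) = (if i = n then pr n (X (pr n v)) else 0)"
      using ge[of i] zero[of n i] by (cases "n < i") (auto simp: not_less)
  qed
  then have "pr n (X v) = pr n (X (pr n v))"
    using finite_pr[of v] X0 by (cases "pr n v = 0") simp_all
  ultimately show ?thesis
    by (simp add: upper_def)
qed

lemma lower_map:
  assumes add: "\<And>u v. X (u + v) = X u + (X v :: 'v)"
    and X: "\<And>m v. v \<in> gr m \<Longrightarrow> X v \<in> lower m"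
    and v: "v \<in> lower n"
  shows "X v \<in> lower n \<and> pr n (X v) = pr n (X (pr n v))"
proof -
  have X0: "X 0 = 0"
    using add[of 0 0] by simp
  have E: "pr k (X v) = (\<Sum>i | pr i v \<noteq> 0. pr k (X (pr i v)))" for k
    using additive_components[of "\<lambda>v. pr k (X v)" v] by (simp add: add pr_add)
  have ge: "n \<ge> i" if "pr i v \<noteq> 0" for i
    using v that by (auto simp: lower_def not_less[symmetric])
  have zero: "pr k (X (pr i v)) = 0" if "k > i" for k i
    using X[OF pr_mem[of i v]] that by (simp add: lower_def)
  have "pr k (X v) = 0" if "k > n" for k
    unfolding E using ge zero order.strict_trans1[OF _ that] by (intro sum.neutral) blast
  moreover have "pr n (X v) = (\<Sum>i | pr i v \<noteq> 0. if i = n then pr n (X (pr n v)) else 0)"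
    unfolding E
  proof (rule sum.cong[OF refl])
    fix i assume "i \<in> {i. pr i v \<noteq> 0}"
    then show "pr n (X (pr i v)) = (if i = n then pr n (X (pr n v)) else 0)"
      using ge[of i] zero[of i n] by (cases "i < n") (auto simp: not_less)
  qed
  then have "pr n (X v) = pr n (X (pr n v))"
    using finite_pr[of v] X0 by (cases "pr n v = 0") simp_all
  ultimately show ?thesis
    by (simp add: lower_def)
qed

end

section \<open>Automorphisms\<close>

text \<open>The inverse map, under a name that does not clash with the inverse in a group.\<close>

abbreviation inv_map :: "('a \<Rightarrow> 'b) \<Rightarrow> 'b \<Rightarrow> 'a"
  where "inv_map \<equiv> inv_into UNIV"

context vertex_algebra
begin

abbreviation AUT :: "('v \<Rightarrow> 'v) set"
  where "AUT \<equiv> Aut scale nprod vac"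

abbreviation AUTG :: "('v \<Rightarrow> 'v) monoid"
  where "AUTG \<equiv> Aut_group scale nprod vac"

lemma Aut_iff: "f \<in> AUT \<longleftrightarrow> (\<forall>u v. f (u + v) = f u + f v) \<and> (\<forall>c v. f (scale c v) = scale c (f v))
    \<and> bij f \<and> (\<forall>a b n. f (nprod a n b) = nprod (f a) n (f b)) \<and> f vac = vac"
  using vector_space_axioms by (auto simp: Aut_def Vector_Spaces.linear_iff)

lemma
  assumes "f \<in> AUT"
  shows Aut_add: "f (u + v) = f u + f v"
    and Aut_scale: "f (scale c v) = scale c (f v)"
    and Aut_bij: "bij f"
    and Aut_nprod: "f (nprod a n b) = nprod (f a) n (f b)"
    and Aut_vac: "f vac = vac"
  using assms by (auto simp: Aut_iff)

lemma Aut_zero_vec: "f \<in> AUT \<Longrightarrow> f 0 = 0"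
  using Aut_add[of f 0 0] by simp

lemma Aut_eq_iff: "f \<in> AUT \<Longrightarrow> f u = f v \<longleftrightarrow> u = v"
  using Aut_bij by (metis bij_pointE)

lemma Aut_diff: "f \<in> AUT \<Longrightarrow> f (u - v) = f u - f v"
  using Aut_add[of f "u - v" v] by simp

lemma Aut_id: "id \<in> AUT"
  by (simp add: Aut_iff)

lemma Aut_comp: "f \<in> AUT \<Longrightarrow> g \<in> AUT \<Longrightarrow> f \<circ> g \<in> AUT"
  by (auto simp: Aut_iff bij_comp)

lemma
  assumes "f \<in> AUT"
  shows Aut_inv_left [simp]: "inv_map f (f v) = v"
    and Aut_inv_right [simp]: "f (inv_map f v) = v"
    and Aut_inv_comp [simp]: "inv_map f \<circ> f = id"
    and Aut_comp_inv [simp]: "f \<circ> inv_map f = id"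
  using Aut_bij[OF assms] by (auto simp: bij_def surj_f_inv_f surj_iff)

lemma Aut_inv: 
  assumes f: "f \<in> AUT"
  shows "inv_map f \<in> AUT"
  unfolding Aut_iff
proof (intro conjI allI)
  have *: "inv_map f u = v" if "u = f v" for u v
    using that f by simp
  show "inv_map f (u + v) = inv_map f u + inv_map f v" for u v
    by (rule *) (simp add: Aut_add f)
  show "inv_map f (scale c v) = scale c (inv_map f v)" for c v
    by (rule *) (simp add: Aut_scale f)
  show "inv_map f (nprod a n b) = nprod (inv_map f a) n (inv_map f b)" for a b n
    by (rule *) (simp add: Aut_nprod f)
  show "inv_map f vac = vac"
    by (rule *) (simp add: Aut_vac f)
  show "bij (inv_map f)"
    using Aut_bij[OF f] by (rule bij_imp_bij_inv)
qed

lemma group_Aut: "group AUTG"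
proof (rule groupI)
  show "\<exists>g\<in>carrier AUTG. g \<otimes>\<^bsub>AUTG\<^esub> f = \<one>\<^bsub>AUTG\<^esub>" if "f \<in> carrier AUTG" for f
    using that Aut_inv by (auto simp: Aut_group_def intro!: bexI[of _ "inv_map f"])
qed (auto simp: Aut_group_def Aut_comp Aut_id comp_assoc)

lemma inv_Aut: "f \<in> AUT \<Longrightarrow> inv\<^bsub>AUTG\<^esub> f = inv_map f"
  by (rule group.inv_equality[OF group_Aut]) (auto simp: Aut_group_def Aut_inv)

end

context graded_vertex_algebra
begin

abbreviation AutP :: "('v \<Rightarrow> 'v) set"
  where "AutP \<equiv> Aut_plus scale nprod vac gr"

abbreviation AutM :: "('v \<Rightarrow> 'v) set"
  where "AutM \<equiv> Aut_minus scale nprod vac gr"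

abbreviation AutZ :: "('v \<Rightarrow> 'v) set"
  where "AutZ \<equiv> Aut_zero scale nprod vac gr"

lemma Aut_plus_iff:
  "f \<in> AutP \<longleftrightarrow> f \<in> AUT \<and> (\<forall>n. \<forall>v\<in>gr n. f v \<in> upper n \<and> pr n (f v) = v)"
  unfolding Aut_plus_def span_upper by auto

lemma Aut_minus_iff:
  "f \<in> AutM \<longleftrightarrow> f \<in> AUT \<and> (\<forall>n. \<forall>v\<in>gr n. f v \<in> lower n \<and> pr n (f v) = v)"
  unfolding Aut_minus_def span_lower by auto

lemma Aut_plus_upper:
  assumes "f \<in> AutP" "v \<in> upper n"
  shows "f v \<in> upper n \<and> pr n (f v) = pr n v"
  using upper_map[of f v n] assms by (auto simp: Aut_plus_iff Aut_add)

lemma Aut_minus_lower: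
  assumes "f \<in> AutM" "v \<in> lower n"
  shows "f v \<in> lower n \<and> pr n (f v) = pr n v"
  using lower_map[of f v n] assms by (auto simp: Aut_minus_iff Aut_add)

lemma Aut_zero_iff: "f \<in> AutZ \<longleftrightarrow> f \<in> AUT \<and> (\<forall>n. f ` gr n = gr n)"
  by (auto simp: Aut_zero_def)

lemma Aut_zero_pr: "f \<in> AutZ \<Longrightarrow> pr n (f v) = f (pr n v)"
  using pr_shift[of f 0 n v] by (force simp: Aut_zero_iff Aut_add)

lemma Aut_plus_id: "id \<in> AutP"
  by (auto simp: Aut_plus_iff Aut_id gr_upper pr_same)

lemma Aut_minus_id: "id \<in> AutM"
  by (auto simp: Aut_minus_iff Aut_id gr_lower pr_same)

lemma Aut_plus_comp: "f \<in> AutP \<Longrightarrow> g \<in> AutP \<Longrightarrow> f \<circ> g \<in> AutP"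
  using Aut_plus_upper[of f] Aut_plus_iff Aut_comp[of f g] by auto

lemma Aut_plus_inv:
  assumes f: "f \<in> AutP"
  shows "inv_map f \<in> AutP"
proof -
  have A: "f \<in> AUT"
    using f by (simp add: Aut_plus_iff)
  have "inv_map f v \<in> upper n \<and> pr n (inv_map f v) = v" if v: "v \<in> gr n" for v n
  proof (cases "inv_map f v = 0")
    case True
    then have "v = 0"
      using Aut_inv_right[OF A, of v] by (simp add: Aut_zero_vec A)
    then show ?thesis
      using True by (simp add: gr_upper)
  next
    case False
    then obtain m where m: "inv_map f v \<in> upper m" "pr m (inv_map f v) \<noteq> 0"
      by (rule nonzero_leading)
    then have "pr m v = pr m (inv_map f v)"
      using Aut_plus_upper[OF f m(1)] A by simp
    with m v have "m = n" "pr m (inv_map f v) = v"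
      by (auto simp: pr_same split: if_splits)
    with m show ?thesis
      by simp
  qed
  then show ?thesis
    by (simp add: Aut_plus_iff Aut_inv A)
qed

lemma Aut_zero_inv:
  assumes f: "f \<in> AutZ"
  shows "inv_map f \<in> AutZ"
proof -
  have A: "f \<in> AUT"
    using f by (simp add: Aut_zero_iff)
  have "inv_map f ` gr n = gr n" for n
  proof -
    have "inv_map f ` gr n = inv_map f ` f ` gr n"
      using f by (simp add: Aut_zero_iff)
    then show ?thesis
      using A by (simp add: image_comp)
  qed
  then show ?thesis
    by (simp add: Aut_zero_iff Aut_inv A)
qed

lemma subgroup_Aut_plus: "subgroup AutP AUTG"
proof
  show "inv\<^bsub>AUTG\<^esub> f \<in> AutP" if "f \<in> AutP" for f
    using that inv_Aut[of f] Aut_plus_inv by (simp add: Aut_plus_iff)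
qed (use Aut_plus_comp Aut_plus_id in \<open>auto simp: Aut_group_def Aut_plus_iff\<close>)

lemma subgroup_Aut_zero: "subgroup AutZ AUTG"
proof
  show "inv\<^bsub>AUTG\<^esub> f \<in> AutZ" if "f \<in> AutZ" for f
    using that inv_Aut[of f] Aut_zero_inv by (simp add: Aut_zero_iff)
  show "f \<otimes>\<^bsub>AUTG\<^esub> g \<in> AutZ" if "f \<in> AutZ" "g \<in> AutZ" for f g
    using that by (simp only: Aut_group_def Aut_zero_iff Aut_comp image_comp[symmetric]
        monoid.simps simp_thms)
qed (auto simp: Aut_group_def Aut_zero_iff Aut_id)

lemma Aut_plus_conj:
  assumes h: "h \<in> AutZ" and k: "k \<in> AutP"
  shows "h \<circ> k \<circ> inv_map h \<in> AutP"
proof -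
  have A: "h \<in> AUT" "k \<in> AUT" and h': "inv_map h \<in> AutZ"
    using assms Aut_zero_inv by (auto simp: Aut_plus_iff Aut_zero_iff)
  have "h (k (inv_map h v)) \<in> upper n \<and> pr n (h (k (inv_map h v))) = v" if "v \<in> gr n" for v n
  proof -
    have "inv_map h v \<in> gr n"
      using that h' by (auto simp: Aut_zero_iff)
    then have "k (inv_map h v) \<in> upper n" "pr n (k (inv_map h v)) = inv_map h v"
      using k by (auto simp: Aut_plus_iff)
    then show ?thesis
      using A by (auto simp: upper_def Aut_zero_pr[OF h] Aut_zero_vec)
  qed
  then show ?thesis
    using A by (auto simp: Aut_plus_iff intro!: Aut_comp Aut_inv)
qed

subsection \<open>Uniqueness of the triangular decomposition\<close>

text \<open>If \<open>g h k = g' h' k'\<close>, then \<open>u = g\<inverse> g' = h k k'\<inverse> h'\<inverse>\<close> is both lower unitriangular and upper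
  triangular. The lower triangular side is used in the form \<open>g u = g'\<close>: since \<open>g\<close> preserves top
  components, the top component of \<open>u v\<close> is that of \<open>g' v\<close>.\<close>

lemma triangular_decomposition_unique:
  assumes g: "g \<in> AutM" and h: "h \<in> AutZ" and k: "k \<in> AutP"
    and g': "g' \<in> AutM" and h': "h' \<in> AutZ" and k': "k' \<in> AutP"
    and eq: "g \<circ> h \<circ> k = g' \<circ> h' \<circ> k'"
  shows "g = g' \<and> h = h' \<and> k = k'"
proof -
  have A: "g \<in> AUT" "h \<in> AUT" "k \<in> AUT" "g' \<in> AUT" "h' \<in> AUT" "k' \<in> AUT"
    using assms by (auto simp: Aut_plus_iff Aut_zero_iff Aut_minus_iff)
  define u where "u = h \<circ> k \<circ> inv_map k' \<circ> inv_map h'"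
  have u: "u \<in> AUT"
    unfolding u_def by (intro Aut_comp Aut_inv A)
  have gu: "g (u v) = g' v" for v
    using fun_cong[OF eq, of "inv_map k' (inv_map h' v)"] A by (simp add: u_def)
  have *: "u v = v \<and> h (inv_map h' v) = v" if v: "v \<in> gr n" for v n
  proof (cases "v = 0")
    case True
    then show ?thesis
      using A u by (simp add: Aut_zero_vec Aut_inv)
  next
    case False
    have "inv_map h' v \<in> gr n"
      using v Aut_zero_inv[OF h'] by (auto simp: Aut_zero_iff)
    then have "inv_map k' (inv_map h' v) \<in> upper n" "pr n (inv_map k' (inv_map h' v)) = inv_map h' v"
      using Aut_plus_inv[OF k'] by (auto simp: Aut_plus_iff)
    then have "k (inv_map k' (inv_map h' v)) \<in> upper n" "pr n (k (inv_map k' (inv_map h' v))) = inv_map h' v"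
      using Aut_plus_upper[OF k] by auto
    then have up: "u v \<in> upper n" "pr n (u v) = h (inv_map h' v)"
      using A by (auto simp: u_def upper_def Aut_zero_pr[OF h] Aut_zero_vec)
    have "u v \<noteq> 0"
      using False Aut_eq_iff[OF u, of v 0] by (simp add: Aut_zero_vec u)
    then obtain m where m: "u v \<in> lower m" "pr m (u v) \<noteq> 0"
      by (rule nonzero_top)
    have low: "g' v \<in> lower n" "pr n (g' v) = v"
      using g' v by (auto simp: Aut_minus_iff)
    have top: "pr m (g' v) = pr m (u v)"
      using Aut_minus_lower[OF g m(1)] by (simp add: gu)
    have "m \<le> n"
      using m(2) low(1) unfolding top[symmetric] by (auto simp: lower_def not_less[symmetric])
    moreover have "n \<le> m"
      using m(2) up(1) by (auto simp: upper_def not_less[symmetric])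
    ultimately have "m = n"
      by simp
    with m(1) up(1) have "u v \<in> gr n"
      by (auto simp: mem_gr_iff upper_def lower_def neq_iff)
    then have "u v = pr n (u v)"
      by (simp add: pr_same)
    then show ?thesis
      using top low(2) up(2) \<open>m = n\<close> by simp
  qed
  have "u v = v \<and> h (inv_map h' v) = v" for v
  proof (induction v rule: homogeneous_induct)
    case (2 v w)
    then show ?case
      using A u by (simp add: Aut_add Aut_inv)
  qed (rule *)
  then have "g = g'" "h = h'"
    using gu Aut_inv_left[OF A(5)] by (metis ext)+
  moreover from this have "k = k'"
    using fun_cong[OF eq] A by (auto simp: Aut_eq_iff)
  ultimately show ?thesis
    by simp
qed

subsection \<open>The associated graded automorphism\<close>

text \<open>The map that an automorphism preserving the filtration \<open>upper\<close> induces on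
  \<open>\<Oplus>\<^sub>n upper n / upper (n + 1)\<close>, with the quotients identified with the spaces \<open>V\<^sub>n\<close>.\<close>

definition gr_map :: "('v \<Rightarrow> 'v) \<Rightarrow> 'v \<Rightarrow> 'v"
  where "gr_map f v = (\<Sum>n | pr n v \<noteq> 0. pr n (f (pr n v)))"

lemma pr_gr_map:
  assumes "f 0 = 0"
  shows "pr n (gr_map f v) = pr n (f (pr n v))"
proof -
  have "pr n (gr_map f v) = (\<Sum>i | pr i v \<noteq> 0. if n = i then pr n (f (pr n v)) else 0)"
    unfolding gr_map_def pr_sum pr_pr by (intro sum.cong) auto
  then show ?thesis
    using finite_pr[of v] assms by (cases "pr n v = 0") simp_all
qed

lemma gr_map_homogeneous:
  assumes "f 0 = 0" "v \<in> gr n"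
  shows "gr_map f v = pr n (f v)"
  by (rule pr_eqI) (use assms in \<open>auto simp: pr_gr_map pr_pr pr_same\<close>)

lemma filtered_decomposition:
  assumes f: "f \<in> AUT" and filt: "\<And>v n. f v \<in> upper n \<longleftrightarrow> v \<in> upper n"
  obtains h k where "h \<in> AutZ" "k \<in> AutP" "f = h \<circ> k"
proof -
  define h where "h = gr_map f"
  have f0: "f 0 = 0"
    using f by (rule Aut_zero_vec)
  have pr_h: "pr n (h v) = pr n (f (pr n v))" for n v
    unfolding h_def using f0 by (rule pr_gr_map)
  have hom: "h v = pr n (f v)" if "v \<in> gr n" for n v
    unfolding h_def using f0 that by (rule gr_map_homogeneous)
  have add: "h (u + v) = h u + h v" for u v
    by (rule pr_eqI) (simp add: pr_h pr_add Aut_add f)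
  have scale: "h (scale c v) = scale c (h v)" for c v
    by (rule pr_eqI) (simp add: pr_h pr_scale Aut_scale f)
  have h0: "h 0 = 0"
    using add[of 0 0] by simp
  have "v = 0" if "h v = 0" for v
  proof (rule pr_eqI)
    fix n
    have "pr n (f (pr n v)) = 0"
      using pr_h[of n v] that by simp
    moreover have "f (pr n v) \<in> upper n"
      by (simp add: filt gr_upper)
    ultimately have "pr n v \<in> upper (n + 1)"
      using upper_Suc filt by blast
    then have "pr n (pr n v) = 0"
      unfolding upper_def by simp
    then show "pr n v = pr n 0"
      by (simp add: pr_pr)
  qed
  moreover have "h (u - v) = h u - h v" for u v
    using add[of "u - v" v] by simp
  ultimately have "inj h"
    by (metis injI eq_iff_diff_eq_0)
  have onto: "\<exists>v\<in>gr n. h v = w" if w: "w \<in> gr n" for n w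
  proof -
    obtain u where u: "f u = w"
      using Aut_inv_right[OF f] by metis
    then have "u \<in> upper n"
      using filt gr_upper[OF w] by blast
    then have "pr n (f u) = pr n (f (pr n u))"
      using upper_map[of f u n] filt gr_upper Aut_add[OF f] by blast
    then have "h (pr n u) = w"
      using u w by (simp add: hom[OF pr_mem] pr_same)
    then show ?thesis
      using pr_mem by blast
  qed
  have "\<exists>v. h v = w" for w
  proof (induction w rule: homogeneous_induct)
    case (1 n w)
    then show ?case using onto by blast
  next
    case (2 w w')
    then show ?case using add by metis
  qed
  then have "bij h"
    using \<open>inj h\<close> unfolding bij_def surj_def by metis
  have nprod: "h (nprod a n b) = nprod (h a) n (h b)" for a n b
  proof (induction a rule: homogeneous_induct)
    case (1 i a)
    show ?case
    proof (induction b rule: homogeneous_induct)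
      case (1 j b)
      have "h (nprod a n b) = pr (i + j - n - 1) (nprod (f a) n (f b))"
        using hom[OF nprod_gr[OF \<open>a \<in> gr i\<close> \<open>b \<in> gr j\<close>, of n]] by (simp add: Aut_nprod f)
      also have "\<dots> = nprod (pr i (f a)) n (pr j (f b))"
        using filt \<open>a \<in> gr i\<close> \<open>b \<in> gr j\<close> gr_upper by (intro pr_nprod_upper) auto
      finally show ?case
        using hom \<open>a \<in> gr i\<close> \<open>b \<in> gr j\<close> by simp
    qed (simp add: nprod_linear add)
  qed (simp add: nprod_linear add)
  have "h vac = vac"
    using hom[OF vac_gr] f by (simp add: Aut_vac pr_same[OF vac_gr])
  with add scale \<open>bij h\<close> nprod have hA: "h \<in> AUT"
    by (simp add: Aut_iff)
  have "h ` gr n = gr n" for n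
    using onto by (auto simp: hom image_iff)
  with hA have hZ: "h \<in> AutZ"
    by (simp add: Aut_zero_iff)
  have "inv_map h (f v) \<in> upper n \<and> pr n (inv_map h (f v)) = v" if "v \<in> gr n" for v n
  proof -
    have "f v \<in> upper n"
      using filt gr_upper that by blast
    moreover have "inv_map h (pr n (f v)) = v"
      using hom[OF that, symmetric] hA by simp
    ultimately show ?thesis
      using hA by (simp add: upper_def Aut_zero_pr[OF Aut_zero_inv[OF hZ]] Aut_zero_vec Aut_inv)
  qed
  then have "inv_map h \<circ> f \<in> AutP"
    by (simp add: Aut_plus_iff Aut_comp Aut_inv hA f)
  moreover have "f = h \<circ> (inv_map h \<circ> f)"
    using hA by (simp flip: comp_assoc)
  ultimately show ?thesis
    using that hZ by blast
qed

end

section \<open>Semidirect products from complements\<close>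

lemma (in group) semidirect_product_iso:
  assumes P: "subgroup P G" and Z: "subgroup Z G"
    and conj: "\<And>z p. z \<in> Z \<Longrightarrow> p \<in> P \<Longrightarrow> z \<otimes> p \<otimes> inv z \<in> P"
    and trivial: "P \<inter> Z = {\<one>}"
    and total: "\<And>f. f \<in> carrier G \<Longrightarrow> \<exists>p\<in>P. \<exists>z\<in>Z. f = p \<otimes> z"
  shows "conjugation_on G P \<in> hom (G\<lparr>carrier := Z\<rparr>) (AutoGroup (G\<lparr>carrier := P\<rparr>))"
    and "G \<cong> semidirect_product (G\<lparr>carrier := P\<rparr>) (G\<lparr>carrier := Z\<rparr>) (conjugation_on G P)"
proof -
  have Pc: "p \<in> carrier G" if "p \<in> P" for p
    using that subgroup.mem_carrier[OF P] by blast
  have Zc: "z \<in> carrier G" if "z \<in> Z" for z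
    using that subgroup.mem_carrier[OF Z] by blast
  have cancel: "inv z \<otimes> (z \<otimes> y) = y" if "z \<in> carrier G" "y \<in> carrier G" for z y
    using that by (simp flip: m_assoc)
  let ?c = "conjugation_on G P"
  have c: "?c z p = z \<otimes> p \<otimes> inv z" if "p \<in> P" for z p
    using that by (simp add: conjugation_on_def)
  have c_mult: "?c z (p \<otimes> q) = ?c z p \<otimes> ?c z q" if "z \<in> Z" "p \<in> P" "q \<in> P" for z p q
    using that subgroup.m_closed[OF P] Pc Zc by (simp add: c m_assoc cancel)
  have c_c: "?c z (?c w p) = ?c (z \<otimes> w) p" if "z \<in> Z" "w \<in> Z" "p \<in> P" for z w p
    using that conj Pc Zc by (simp add: c m_assoc inv_mult_group)
  have c_one: "?c \<one> p = p" if "p \<in> P" for p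
    using that Pc by (simp add: c)
  have c_mem: "?c z p \<in> P" if "z \<in> Z" "p \<in> P" for z p
    using that conj by (simp add: c)
  have c_Bij: "?c z \<in> Bij P" if z: "z \<in> Z" for z
  proof -
    have iz: "inv z \<in> Z"
      using z subgroup.m_inv_closed[OF Z] by blast
    have "bij_betw (?c z) P P"
    proof (rule bij_betw_byWitness[of _ "?c (inv z)"])
      show "\<forall>p\<in>P. ?c (inv z) (?c z p) = p" "\<forall>p\<in>P. ?c z (?c (inv z) p) = p"
        using c_c[OF iz z] c_c[OF z iz] c_one Zc[OF z] by simp_all
      show "?c z ` P \<subseteq> P" "?c (inv z) ` P \<subseteq> P"
        using c_mem z iz by blast+
    qed
    then show ?thesis
      by (simp add: Bij_def conjugation_on_def)
  qed
  show "?c \<in> hom (G\<lparr>carrier := Z\<rparr>) (AutoGroup (G\<lparr>carrier := P\<rparr>))"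
  proof (rule homI)
    fix z assume "z \<in> carrier (G\<lparr>carrier := Z\<rparr>)"
    then have "z \<in> Z"
      by simp
    then have "?c z \<in> hom (G\<lparr>carrier := P\<rparr>) (G\<lparr>carrier := P\<rparr>)"
      using c_mem c_mult by (intro homI) simp_all
    then show "?c z \<in> carrier (AutoGroup (G\<lparr>carrier := P\<rparr>))"
      using c_Bij[OF \<open>z \<in> Z\<close>] by (simp add: AutoGroup_def auto_def)
  next
    fix z w assume "z \<in> carrier (G\<lparr>carrier := Z\<rparr>)" "w \<in> carrier (G\<lparr>carrier := Z\<rparr>)"
    then have zw: "z \<in> Z" "w \<in> Z"
      by simp_all
    have "?c (z \<otimes> w) p = compose P (?c z) (?c w) p" for p
    proof (cases "p \<in> P")
      case True
      then show ?thesis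
        using c_c[OF zw] by (simp add: compose_def)
    qed (simp add: compose_def conjugation_on_def)
    then have "?c (z \<otimes> w) = compose P (?c z) (?c w)" ..
    then show "?c (z \<otimes>\<^bsub>G\<lparr>carrier := Z\<rparr>\<^esub> w) = ?c z \<otimes>\<^bsub>AutoGroup (G\<lparr>carrier := P\<rparr>)\<^esub> ?c w"
      using zw c_Bij by (simp add: AutoGroup_def BijGroup_def)
  qed
  let ?S = "semidirect_product (G\<lparr>carrier := P\<rparr>) (G\<lparr>carrier := Z\<rparr>) ?c"
  define M where "M = (\<lambda>(p, z). p \<otimes> z)"
  have inj: "inj_on M (P \<times> Z)"
  proof (rule inj_onI, clarify)
    fix p z p' z' assume a: "p \<in> P" "z \<in> Z" "p' \<in> P" "z' \<in> Z" and "M (p, z) = M (p', z')"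
    then have eq: "p \<otimes> z = p' \<otimes> z'"
      by (simp add: M_def)
    have "p = p' \<otimes> (z' \<otimes> inv z)"
      using eq a Pc Zc by (simp add: m_assoc[symmetric] inv_solve_right)
    then have "inv p' \<otimes> p = z' \<otimes> inv z"
      using a Pc Zc by (simp add: inv_solve_left')
    moreover have "inv p' \<otimes> p \<in> P" "z' \<otimes> inv z \<in> Z"
      using a P Z by (simp_all add: subgroup.m_closed subgroup.m_inv_closed)
    ultimately have "inv p' \<otimes> p = \<one>" "z' \<otimes> inv z = \<one>"
      using trivial by auto
    then show "p = p' \<and> z = z'"
      using a Pc Zc by (simp add: inv_solve_left' inv_solve_right')
  qed
  have img: "M ` (P \<times> Z) = carrier G"
    using total Pc Zc by (force simp: M_def)
  have M_mult: "M (x \<otimes>\<^bsub>?S\<^esub> y) = M x \<otimes> M y" if "x \<in> P \<times> Z" "y \<in> P \<times> Z" for x y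
    using that Pc Zc by (auto simp: M_def semidirect_product_def c m_assoc cancel)
  have S_closed: "x \<otimes>\<^bsub>?S\<^esub> y \<in> P \<times> Z" if "x \<in> P \<times> Z" "y \<in> P \<times> Z" for x y
    using that c_mem subgroup.m_closed[OF P] subgroup.m_closed[OF Z]
    by (auto simp: semidirect_product_def)
  define F where "F = inv_into (P \<times> Z) M"
  have F_mem: "F f \<in> P \<times> Z" and MF: "M (F f) = f" if "f \<in> carrier G" for f
    using that inv_into_into[of f M "P \<times> Z"] f_inv_into_f[of f M "P \<times> Z"]
    unfolding F_def img by auto
  have "F \<in> iso G ?S"
  proof (rule isoI)
    show "F \<in> hom G ?S"
    proof (rule homI)
      show "F f \<in> carrier ?S" if "f \<in> carrier G" for f
        using F_mem[OF that] by (simp add: semidirect_product_def)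
      fix f g assume fg: "f \<in> carrier G" "g \<in> carrier G"
      then have "M (F (f \<otimes> g)) = M (F f \<otimes>\<^bsub>?S\<^esub> F g)"
        using M_mult[OF F_mem F_mem] MF by simp
      then show "F (f \<otimes> g) = F f \<otimes>\<^bsub>?S\<^esub> F g"
        using inj_onD[OF inj] F_mem S_closed fg by (meson m_closed)
    qed
    show "bij_betw F (carrier G) (carrier ?S)"
      using bij_betw_inv_into[of M "P \<times> Z" "carrier G"] inj img
      by (simp add: F_def bij_betw_def semidirect_product_def)
  qed
  then show "G \<cong> ?S"
    by (auto simp: is_iso_def)
qed

section \<open>Exponentials of lowering derivations\<close>

text \<open>The exponential \<open>\<Sum>\<^sub>j E\<^sup>j v / j!\<close> of a locally nilpotent linear map \<open>E\<close>. Where infinitely many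
  terms are nonzero, \<open>Sum_any\<close> makes it \<open>0\<close>.\<close>

definition (in vertex_algebra) exp_map :: "('v \<Rightarrow> 'v) \<Rightarrow> 'v \<Rightarrow> 'v"
  where "exp_map E v = Sum_any (\<lambda>j. scale (1 / fact j) ((E ^^ j) v))"

context CFT_type_VOA
begin

lemma lower_neg: "n < 0 \<Longrightarrow> lower n = {0}"
proof -
  assume n: "n < 0"
  have "v = 0" if "v \<in> lower n" for v
  proof (rule pr_eqI)
    fix k
    show "pr k v = pr k 0"
      using that pr_mem[of k v] gr_neg[of k] n by (cases "k < 0") (auto simp: lower_def)
  qed
  then show ?thesis
    by (auto simp: lower_def)
qed

lemma upper_nonpos: "n \<le> 0 \<Longrightarrow> upper n = UNIV"
proof -
  assume "n \<le> 0"
  then have "pr k v = 0" if "k < n" for k v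
    using pr_mem[of k v] gr_neg[of k] that by simp
  then show "upper n = UNIV"
    by (auto simp: upper_def)
qed

lemma lower_unitriangular_bij:
  assumes add: "\<And>u v. X (u + v) = X u + X v"
    and X: "\<And>m v. v \<in> gr m \<Longrightarrow> X v \<in> lower m \<and> pr m (X v) = v"
  shows "bij X"
proof -
  have X0: "X 0 = 0"
    using add[of 0 0] by simp
  have low: "X v \<in> lower n \<and> pr n (X v) = pr n v" if "v \<in> lower n" for v n
    using lower_map[of X v n, OF add] X that by simp
  have "v = 0" if "X v = 0" for v
  proof (rule ccontr)
    assume "v \<noteq> 0"
    then obtain n where "v \<in> lower n" "pr n v \<noteq> 0"
      by (rule nonzero_top)
    then show False
      using low[of v n] that by simp
  qed
  moreover have "X (u - v) = X u - X v" for u v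
    using add[of "u - v" v] by simp
  ultimately have "inj X"
    by (metis injI eq_iff_diff_eq_0)
  moreover have *: "\<exists>u. X u = v" if "v \<in> lower (int n - 1)" for n v
    using that
  proof (induction n arbitrary: v)
    case 0
    then show ?case
      using X0 lower_neg[of "-1"] by auto
  next
    case (Suc n)
    define w where "w = pr (int n) v"
    have w: "X w \<in> lower (int n)" "pr (int n) (X w) = w"
      using X[of w "int n"] by (auto simp: w_def)
    have "v - w \<in> lower (int n - 1)"
      using lower_minus_pr[of v "int n"] Suc.prems by (simp add: w_def)
    moreover have "X w - w \<in> lower (int n - 1)"
      using lower_minus_pr[OF w(1)] w(2) by simp
    ultimately have "(v - w) - (X w - w) \<in> lower (int n - 1)"
      by (rule subspace_diff[OF subspace_lower])
    then obtain u where "X u = v - X w"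
      using Suc.IH by auto
    then have "X (u + w) = v"
      by (simp add: add)
    then show ?case ..
  qed
  have "\<exists>u. X u = v" for v
  proof -
    obtain n where "v \<in> lower n"
      using ex_lower by blast
    then have "v \<in> lower (int (nat (n + 1)) - 1)"
      using lower_mono[of n "int (nat (n + 1)) - 1"] by auto
    then show ?thesis
      by (rule *)
  qed
  ultimately show ?thesis
    unfolding bij_def surj_def by metis
qed

end

text \<open>A derivation of all products that lowers weights by one. It is locally nilpotent because the
  weights are bounded below.\<close>

locale lowering_derivation = CFT_type_VOA scale nprod vac gr \<omega>
  for scale :: "'k::field_char_0 \<Rightarrow> 'v::ab_group_add \<Rightarrow> 'v" and nprod vac gr \<omega> +
  fixes E :: "'v \<Rightarrow> 'v"
  assumes E_add: "E (u + v) = E u + E v"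
    and E_scale: "E (scale c v) = scale c (E v)"
    and E_derivation: "E (nprod a n b) = nprod (E a) n b + nprod a n (E b)"
    and E_lowers: "v \<in> gr n \<Longrightarrow> E v \<in> gr (n - 1)"
begin

lemma funpow_E_add: "(E ^^ j) (u + v) = (E ^^ j) u + (E ^^ j) v"
  by (induction j) (auto simp: E_add)

lemma funpow_E_scale: "(E ^^ j) (scale c v) = scale c ((E ^^ j) v)"
  by (induction j) (auto simp: E_scale)

lemma E_zero [simp]: "E 0 = 0"
  using E_add[of 0 0] by simp

lemma funpow_E_zero [simp]: "(E ^^ j) 0 = 0"
  by (induction j) auto

lemma funpow_E_gr: "v \<in> gr n \<Longrightarrow> (E ^^ j) v \<in> gr (n - int j)"
proof (induction j)
  case (Suc j)
  then show ?case
    using E_lowers[of "(E ^^ j) v" "n - int j"] by (simp add: algebra_simps)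
qed simp

lemma funpow_E_eventually_zero: "(E ^^ N) v = 0 \<Longrightarrow> N \<le> j \<Longrightarrow> (E ^^ j) v = 0"
  using funpow_add[of "j - N" N E] by simp

lemma locally_nilpotent: "\<exists>N. (E ^^ N) v = 0"
proof (induction v rule: homogeneous_induct)
  case (1 n v)
  have "(E ^^ nat (n + 1)) v \<in> gr (n - int (nat (n + 1)))"
    using 1 by (rule funpow_E_gr)
  then show ?case
    using gr_neg[of "n - int (nat (n + 1))"] by auto
next
  case (2 u v)
  then obtain M N where "(E ^^ M) u = 0" "(E ^^ N) v = 0"
    by blast
  then have "(E ^^ max M N) u = 0" "(E ^^ max M N) v = 0"
    by (auto intro: funpow_E_eventually_zero)
  then have "(E ^^ max M N) (u + v) = 0"
    by (simp add: funpow_E_add)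
  then show ?case ..
qed

lemma exp_map_eq:
  assumes "(E ^^ N) v = 0"
  shows "exp_map E v = (\<Sum>j<N. scale (1 / fact j) ((E ^^ j) v))"
  unfolding exp_map_def
proof (rule Sum_any.expand_superset)
  show "{j. scale (1 / fact j) ((E ^^ j) v) \<noteq> 0} \<subseteq> {..<N}"
    using funpow_E_eventually_zero[OF assms] by (auto simp: not_le[symmetric])
qed simp

lemma exp_map_add: "exp_map E (u + v) = exp_map E u + exp_map E v"
proof -
  obtain M N where "(E ^^ M) u = 0" "(E ^^ N) v = 0"
    using locally_nilpotent by metis
  then have "(E ^^ max M N) u = 0" "(E ^^ max M N) v = 0"
    by (auto intro: funpow_E_eventually_zero)
  then show ?thesis
    by (simp add: exp_map_eq[of "max M N"] funpow_E_add scale_right_distrib sum.distrib)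
qed

lemma exp_map_scale: "exp_map E (scale c v) = scale c (exp_map E v)"
proof -
  obtain N where "(E ^^ N) v = 0"
    using locally_nilpotent by metis
  then show ?thesis
    by (simp add: exp_map_eq[of N] funpow_E_scale scale_sum_right mult.commute)
qed

text \<open>The Leibniz rule for divided powers.\<close>

lemma Leibniz:
  "scale (1 / fact k) ((E ^^ k) (nprod a n b)) =
    (\<Sum>i\<le>k. nprod (scale (1 / fact i) ((E ^^ i) a)) n
        (scale (1 / fact (k - i)) ((E ^^ (k - i)) b)))"
proof (induction k)
  case (Suc k)
  define A where "A = (\<lambda>i. scale (1 / fact i) ((E ^^ i) a))"
  define B where "B = (\<lambda>i. scale (1 / fact i) ((E ^^ i) b))"
  have step: "E (scale (1 / fact i) ((E ^^ i) v)) =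
      scale (of_nat (Suc i)) (scale (1 / fact (Suc i)) ((E ^^ Suc i) v))" for i v
    using of_nat_neq_0[of i, where 'a = 'k] by (simp add: E_scale)
  have EA: "E (A i) = scale (of_nat (Suc i)) (A (Suc i))"
    and EB: "E (B i) = scale (of_nat (Suc i)) (B (Suc i))" for i
    unfolding A_def B_def by (rule step)+
  have E_sum: "E (sum f S) = (\<Sum>i\<in>S. E (f i))" for f :: "nat \<Rightarrow> 'v" and S
    by (rule additive_sum) (rule E_add)
  have "scale (of_nat (Suc k)) (scale (1 / fact (Suc k)) ((E ^^ Suc k) (nprod a n b))) =
      E (scale (1 / fact k) ((E ^^ k) (nprod a n b)))"
    by (rule step[symmetric])
  also have "\<dots> = E (\<Sum>i\<le>k. nprod (A i) n (B (k - i)))"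
    using Suc.IH by (simp add: A_def B_def)
  also have "\<dots> = (\<Sum>i\<le>k. scale (of_nat (Suc i)) (nprod (A (Suc i)) n (B (k - i)))) +
      (\<Sum>i\<le>k. scale (of_nat (Suc (k - i))) (nprod (A i) n (B (Suc (k - i)))))"
    by (simp add: E_sum E_derivation EA EB nprod_linear sum.distrib del: of_nat_Suc)
  also have "(\<Sum>i\<le>k. scale (of_nat (Suc i)) (nprod (A (Suc i)) n (B (k - i)))) =
      (\<Sum>i\<le>Suc k. scale (of_nat i) (nprod (A i) n (B (Suc k - i))))"
    by (subst sum.atMost_Suc_shift) simp
  also have "(\<Sum>i\<le>k. scale (of_nat (Suc (k - i))) (nprod (A i) n (B (Suc (k - i))))) =
      (\<Sum>i\<le>Suc k. scale (of_nat (Suc k - i)) (nprod (A i) n (B (Suc k - i))))"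
    by (subst sum.atMost_Suc) (simp add: Suc_diff_le del: of_nat_Suc of_nat_diff)
  also have "(\<Sum>i\<le>Suc k. scale (of_nat i) (nprod (A i) n (B (Suc k - i)))) +
      (\<Sum>i\<le>Suc k. scale (of_nat (Suc k - i)) (nprod (A i) n (B (Suc k - i)))) =
      (\<Sum>i\<le>Suc k. scale (of_nat (Suc k)) (nprod (A i) n (B (Suc k - i))))"
    unfolding sum.distrib[symmetric]
    by (intro sum.cong[OF refl])
      (simp add: scale_left_distrib[symmetric] of_nat_add[symmetric] del: of_nat_Suc of_nat_add)
  also have "\<dots> = scale (of_nat (Suc k)) (\<Sum>i\<le>Suc k. nprod (A i) n (B (Suc k - i)))"
    by (rule scale_sum_right[symmetric])
  finally show ?case
    using of_nat_neq_0[of k, where 'a = 'k] unfolding A_def B_def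
    by (simp only: scale_cancel_left) simp
qed simp

lemma exp_map_nprod: "exp_map E (nprod a n b) = nprod (exp_map E a) n (exp_map E b)"
proof -
  obtain M N where "(E ^^ M) a = 0" "(E ^^ N) b = 0"
    using locally_nilpotent by metis
  define K where "K = max M N"
  have K: "(E ^^ j) a = 0" "(E ^^ j) b = 0" if "K \<le> j" for j
    using that funpow_E_eventually_zero[OF \<open>(E ^^ M) a = 0\<close>, of j]
      funpow_E_eventually_zero[OF \<open>(E ^^ N) b = 0\<close>, of j] by (auto simp: K_def)
  define g where "g = (\<lambda>i j. nprod (scale (1 / fact i) ((E ^^ i) a)) n
        (scale (1 / fact j) ((E ^^ j) b)))"
  have g0: "g i j = 0" if "K \<le> i \<or> K \<le> j" for i j
    using K that by (auto simp: g_def)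
  have L: "scale (1 / fact k) ((E ^^ k) (nprod a n b)) = (\<Sum>i\<le>k. g i (k - i))" for k
    using Leibniz by (simp add: g_def)
  have "(\<Sum>i\<le>k. g i (k - i)) = 0" if "K + K \<le> k" for k
    using that by (intro sum.neutral ballI g0) auto
  then have "(E ^^ (K + K)) (nprod a n b) = 0"
    using L[of "K + K"] by simp
  then have "exp_map E (nprod a n b) = (\<Sum>k<K + K. \<Sum>i\<le>k. g i (k - i))"
    by (simp add: exp_map_eq L)
  also have "\<dots> = (\<Sum>(i, j)\<in>{(i, j). i + j < K + K}. g i j)"
    by (rule sum.triangle_reindex[symmetric])
  also have "\<dots> = (\<Sum>(i, j)\<in>{..<K} \<times> {..<K}. g i j)"
  proof (rule sum.mono_neutral_right)
    show "finite {(i, j). i + j < K + K}"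
      by (rule finite_subset[of _ "{..<K + K} \<times> {..<K + K}"]) auto
  qed (auto intro!: g0 simp: not_less)
  also have "\<dots> = (\<Sum>i<K. \<Sum>j<K. g i j)"
    by (rule sum.cartesian_product[symmetric])
  also have "\<dots> = nprod (\<Sum>i<K. scale (1 / fact i) ((E ^^ i) a)) n
      (\<Sum>j<K. scale (1 / fact j) ((E ^^ j) b))"
    unfolding nprod_sum_left unfolding nprod_sum_right g_def ..
  also have "\<dots> = nprod (exp_map E a) n (exp_map E b)"
    using K by (simp add: exp_map_eq[of K])
  finally show ?thesis .
qed

lemma E_vac: "E vac = 0"
  using E_derivation[of vac "-1" vac] by (simp add: vacuum creation)

lemma exp_map_vac: "exp_map E vac = vac"
  using exp_map_eq[of 1 vac] by (simp add: E_vac)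

lemma exp_map_unitriangular:
  assumes v: "v \<in> gr n"
  shows "exp_map E v \<in> lower n \<and> pr n (exp_map E v) = v"
proof -
  obtain N where "(E ^^ N) v = 0"
    using locally_nilpotent by blast
  then have "(E ^^ Suc N) v = 0"
    by simp
  then have "exp_map E v = (\<Sum>j<Suc N. scale (1 / fact j) ((E ^^ j) v))"
    by (rule exp_map_eq)
  also have "\<dots> = v + (\<Sum>j<N. scale (1 / fact (Suc j)) ((E ^^ Suc j) v))"
    by (subst sum.lessThan_Suc_shift) simp
  finally have e: "exp_map E v = v + (\<Sum>j<N. scale (1 / fact (Suc j)) ((E ^^ Suc j) v))" .
  have "pr k (scale (1 / fact (Suc j)) ((E ^^ Suc j) v)) = 0" if "n \<le> k" for k j
    using pr_same[OF funpow_E_gr[OF v, of "Suc j"], of k] that by (simp add: pr_scale)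
  then have "pr k (exp_map E v) = pr k v" if "n \<le> k" for k
    unfolding e pr_add pr_sum using that by simp
  then show ?thesis
    using v by (auto simp: lower_def pr_same)
qed

theorem exp_map_Aut_minus: "exp_map E \<in> AutM"
  using exp_map_unitriangular exp_map_add exp_map_scale exp_map_nprod exp_map_vac
    lower_unitriangular_bij[of "exp_map E"]
  by (simp add: Aut_minus_iff Aut_iff)

end

section \<open>Vectors with vanishing zero mode\<close>

context conformal_vertex_algebra
begin

abbreviation T :: "'v \<Rightarrow> 'v"
  where "T v \<equiv> nprod v (-2) vac"

lemma T_vac: "T vac = 0"
  by (simp add: vacuum)

lemma pr_T: "pr n (T v) = T (pr (n - 1) v)"
  using pr_nprod_right[OF vac_gr, of n v "-2"] by simp

lemma pr_L_0: "pr n (nprod \<omega> 1 v) = scale (of_int n) (pr n v)"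
  using pr_nprod_left[OF omega_gr, of n 1 v] by (simp add: L_0[OF pr_mem])

text \<open>The kernel of \<open>T\<close> consists of vectors whose only nonzero mode is \<open>v(-1)\<close>; by skew symmetry
  \<open>L(0)v = \<omega>(1)v\<close> vanishes.\<close>

lemma ker_T:
  assumes "T v = 0"
  shows "v \<in> gr 0"
proof -
  have "nprod v (1 + int i) \<omega> = 0" for i
  proof -
    have "scale (- of_int (2 + int i)) (nprod v (2 + int i - 1) \<omega>) = 0"
      using nprod_translation[of v "2 + int i" \<omega>] assms by simp
    moreover have "(of_int (2 + int i) :: 'k) \<noteq> 0"
      unfolding of_int_eq_0_iff by simp
    ultimately have "nprod v (2 + int i - 1) \<omega> = 0"
      by (metis neg_equal_0_iff_equal scale_eq_0_iff)
    then show ?thesis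
      by (simp add: algebra_simps)
  qed
  then have "nprod \<omega> 1 v = 0"
    using skew_symmetry[of 0 v 1 \<omega>] by simp
  then have "scale (of_int n) (pr n v) = 0" for n
    using pr_L_0[of n v] by simp
  then show ?thesis
    by (auto simp: mem_gr_iff)
qed

text \<open>Skew symmetry applied to \<open>a(0)\<omega> = 0\<close> gives \<open>(n - 1)Ta \<in> T(TV)\<close>.\<close>

lemma zero_mode_range_T:
  assumes a: "a \<in> gr n" and n: "n \<ge> 2" and zero: "\<And>b. nprod a 0 b = 0"
  shows "a \<in> range T"
proof -
  obtain M where M: "\<And>k. k \<ge> M \<Longrightarrow> nprod \<omega> k a = 0"
    using truncation by metis
  define N where "N = nat M"
  have N: "nprod \<omega> (0 + int i) a = 0" if "i \<ge> Suc (Suc N)" for i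
    using that by (intro M) (simp add: N_def)
  have "0 = (\<Sum>i<Suc (Suc N). scale ((-1) ^ i) (nprod (nprod \<omega> (0 + int i) a) (-1 - int i) vac))"
    using skew_symmetry[of "Suc (Suc N)" \<omega> 0 a, OF N] zero[of \<omega>] by simp
  also have "\<dots> = T a - T (scale (of_int n) a) +
      (\<Sum>i<N. scale ((-1) ^ i)
        (nprod (nprod \<omega> (2 + int i) a) (-1 - int (Suc (Suc i))) vac))"
    by (simp add: sum.lessThan_Suc_shift creation L_minus_1 L_0[OF a] algebra_simps del: sum.lessThan_Suc)
  finally have "T (scale (of_int n) a) - T a = (\<Sum>i<N. scale ((-1) ^ i)
        (nprod (nprod \<omega> (2 + int i) a) (-1 - int (Suc (Suc i))) vac))"
    by (simp only: diff_eq_eq add.commute) (simp add: algebra_simps)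
  then have *: "T (scale (of_int n - 1) a) = (\<Sum>i<N. scale ((-1) ^ i)
        (nprod (nprod \<omega> (2 + int i) a) (-1 - int (Suc (Suc i))) vac))"
    by (simp only: scale_left_diff_distrib scale_one nprod_diff_left)
  have "\<exists>y. nprod x (-1 - int (Suc (Suc i))) vac = T (T y)" for x i
    using nprod_vac_range_TT[of x i] by blast
  then obtain Y where Y: "nprod x (-1 - int (Suc (Suc i))) vac = T (T (Y x i))" for x i
    by metis
  have "T (scale (of_int n - 1) a) = T (T (\<Sum>i<N. scale ((-1) ^ i) (Y (nprod \<omega> (2 + int i) a) i)))"
    unfolding * Y by (simp add: nprod_sum_left nprod_scale_left)
  then obtain y where "T (scale (of_int n - 1) a) = T (T y)"
    by blast
  then have "scale (of_int n - 1) a - T y \<in> gr 0"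
    by (intro ker_T) (simp add: nprod_diff_left)
  then have "pr n (scale (of_int n - 1) a - T y) = 0"
    using n by (simp add: pr_same)
  then have "scale (of_int n - 1) a = T (pr (n - 1) y)"
    using a by (simp add: pr_diff pr_scale pr_T pr_same)
  then have "scale (inverse (of_int n - 1)) (scale (of_int n - 1) a) =
      T (scale (inverse (of_int n - 1)) (pr (n - 1) y))"
    by (simp add: nprod_scale_left)
  moreover have "(of_int n - 1 :: 'k) \<noteq> 0"
    using n of_int_eq_1_iff[where 'a = 'k, of n] by auto
  ultimately show ?thesis
    by auto
qed

text \<open>Since \<open>L(-1) = T\<close> is determined by the products, an automorphism commutes with \<open>\<omega>(0)\<close>,
  although it need not fix \<open>\<omega>\<close>.\<close>

lemma Aut_omega_zero_mode:
  assumes f: "f \<in> AUT"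
  shows "nprod (pr n (f \<omega> - \<omega>)) 0 b = 0"
proof -
  have zero: "nprod (f \<omega> - \<omega>) 0 b = 0" for b
  proof -
    have "nprod (f \<omega>) 0 (f c) = T (f c)" for c
      using f by (simp add: Aut_nprod[symmetric] L_minus_1) (simp add: Aut_nprod Aut_vac)
    from this[of "inv_map f b"] show ?thesis
      using f by (simp add: nprod_diff_left L_minus_1)
  qed
  show ?thesis
  proof (induction b rule: homogeneous_induct)
    case (1 m b)
    then show ?case
      using pr_nprod_right[of b m "n + m - 1" "f \<omega> - \<omega>" 0] zero[of b] by simp
  qed (simp add: nprod_add_right)
qed

end

context CFT_type_VOA
begin

lemma T_gr_0: "v \<in> gr 0 \<Longrightarrow> T v = 0"
  unfolding gr_0 by (auto simp: span_singleton nprod_scale_left T_vac)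

end

context strong_CFT_type_VOA
begin

lemma weight_one_first_mode_omega:
  assumes a: "a \<in> gr 1"
  shows "nprod a 1 \<omega> = a"
proof -
  have "nprod \<omega> (1 + int i) a = 0" if "i \<ge> 1" for i
  proof (cases "i = 1")
    case True
    then show ?thesis
      using L_1[OF a] by simp
  next
    case False
    then have "nprod \<omega> (1 + int i) a \<in> gr (1 - int i)" "1 - int i < 0"
      using nprod_gr[OF omega_gr a, of "1 + int i"] that by auto
    then show ?thesis
      using gr_neg by blast
  qed
  then have "nprod a 1 \<omega> = scale (- ((-1) powi 1))
    (\<Sum>i<1. scale ((-1) ^ i) (nprod (nprod \<omega> (1 + int i) a) (-1 - int i) vac))"
    by (rule skew_symmetry)
  then show ?thesis
    using L_0[OF a] by (simp add: creation)
qed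

lemma weight_two_first_mode_omega:
  assumes a: "a \<in> gr 2" and zero: "\<And>b. nprod a 0 b = 0"
  shows "nprod a 1 \<omega> = 0"
proof -
  obtain b' where "a = T b'"
    using zero_mode_range_T[OF a _ zero] by auto
  define b where "b = pr 1 b'"
  have b: "b \<in> gr 1" "a = T b"
    using a \<open>a = T b'\<close> pr_T[of 2 b'] by (auto simp: b_def pr_same)
  have "nprod \<omega> (0 + int i) b = 0" if "i \<ge> 2" for i
  proof (cases "i = 2")
    case True
    then show ?thesis
      using L_1[OF b(1)] by simp
  next
    case False
    then have "nprod \<omega> (0 + int i) b \<in> gr (2 - int i)" "2 - int i < 0"
      using nprod_gr[OF omega_gr b(1), of "0 + int i"] that by auto
    then show ?thesis
      using gr_neg by blast
  qed
  then have "nprod b 0 \<omega> = scale (- ((-1) powi 0))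
    (\<Sum>i<2. scale ((-1) ^ i) (nprod (nprod \<omega> (0 + int i) b) (-1 - int i) vac))"
    by (rule skew_symmetry)
  then have "nprod b 0 \<omega> = 0"
    using L_0[OF b(1)] by (simp add: creation L_minus_1 numeral_2_eq_2)
  then show ?thesis
    unfolding b(2) nprod_translation by simp
qed

section \<open>Removing the component of weight one\<close>

lemma exp_weight_one:
  assumes a: "a \<in> gr 1" and zero: "\<And>b. nprod a 0 b = 0"
  shows "exp_map (nprod a 1) \<in> AutM" and "pr 1 (exp_map (nprod a 1) \<omega>) = a"
proof -
  interpret E: lowering_derivation scale nprod vac gr \<omega> "nprod a 1"
  proof
    show "nprod a 1 v \<in> gr (n - 1)" if "v \<in> gr n" for v n
      using nprod_gr[OF a that, of 1] by simp
  qed (auto simp: nprod_linear first_mode_derivation zero)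
  show "exp_map (nprod a 1) \<in> AutM"
    by (rule E.exp_map_Aut_minus)
  have aa: "nprod a 1 a \<in> gr 0" "nprod a 1 (nprod a 1 a) = 0"
    using E.E_lowers[OF a] E.E_lowers[of "nprod a 1 a" 0] gr_neg[of "-1"] by auto
  then have "(nprod a 1 ^^ 3) \<omega> = 0"
    by (simp add: numeral_3_eq_3 weight_one_first_mode_omega[OF a])
  then have "exp_map (nprod a 1) \<omega> = \<omega> + a + scale (1 / fact 2) (nprod a 1 a)"
    by (subst E.exp_map_eq, assumption)
      (simp add: numeral_3_eq_3 numeral_2_eq_2 weight_one_first_mode_omega[OF a])
  then show "pr 1 (exp_map (nprod a 1) \<omega>) = a"
    using a aa(1) by (simp add: pr_add pr_scale pr_same[OF omega_gr] pr_same)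
qed

text \<open>The weight one component \<open>a\<close> of \<open>f \<omega>\<close> lies in \<open>J\<^sub>1(V)\<close>. Write \<open>f = g f'\<close> with
  \<open>g = exp(a(1))\<close> and \<open>z = f' \<omega>\<close>. All components of \<open>z - \<omega>\<close> of weight at least \<open>2\<close> lie in \<open>TV\<close>,
  where \<open>g\<close> creates nothing of weight one because \<open>T V\<^sub>0 = 0\<close>; hence \<open>a\<close>, the component of
  \<open>g z\<close>, is the sum of \<open>a\<close>, coming from \<open>g \<omega>\<close>, and the component of \<open>z\<close>.\<close>

lemma remove_weight_one:
  assumes f: "f \<in> AUT"
  obtains g f' where "g \<in> AutM" "f' \<in> AUT" "f = g \<circ> f'" "pr 1 (f' \<omega>) = 0"
    "J_1 nprod gr = {0} \<Longrightarrow> g = id"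
proof -
  define a where "a = pr 1 (f \<omega>)"
  have pr_omega: "pr 1 \<omega> = 0"
    using pr_same[OF omega_gr, of 1] by simp
  have a: "a \<in> gr 1" and zero: "nprod a 0 b = 0" for b
    using Aut_omega_zero_mode[OF f, of 1 b] by (simp_all add: a_def pr_diff pr_omega)
  define g where "g = exp_map (nprod a 1)"
  have g: "g \<in> AutM" and g\<omega>: "pr 1 (g \<omega>) = a"
    unfolding g_def using exp_weight_one[OF a zero] by auto
  have gA: "g \<in> AUT"
    using g by (simp add: Aut_minus_iff)
  define f' where "f' = inv_map g \<circ> f"
  have f': "f' \<in> AUT" "f = g \<circ> f'"
    using f gA by (auto simp: f'_def Aut_comp Aut_inv simp flip: comp_assoc)
  define z where "z = f' \<omega>"
  define c where "c = z - \<omega>"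
  have c_zero: "nprod (pr n c) 0 b = 0" for n b
    unfolding c_def z_def by (rule Aut_omega_zero_mode[OF f'(1)])
  have comp: "pr 1 (g (pr i c)) = (if i = 1 then pr 1 c else 0)" for i
  proof -
    consider "i \<le> 0" | "i = 1" | "i \<ge> 2"
      by linarith
    then show ?thesis
    proof cases
      case 1
      then show ?thesis
        using Aut_minus_lower[OF g gr_lower[OF pr_mem], of i c] by (auto simp: lower_def)
    next
      case 2
      then show ?thesis
        using Aut_minus_lower[OF g gr_lower[OF pr_mem], of 1 c] by (simp add: pr_pr)
    next
      case 3
      then obtain y where y: "pr i c = T y"
        using zero_mode_range_T[OF pr_mem _ c_zero, of i] by blast
      have "g (T y) = T (g y)"
        using gA by (simp add: Aut_nprod Aut_vac)
      then show ?thesis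
        using 3 T_gr_0[OF pr_mem, of "g y"] by (simp add: y pr_T)
    qed
  qed
  have "pr 1 (g c) = (\<Sum>i | pr i c \<noteq> 0. pr 1 (g (pr i c)))"
    by (rule additive_components) (simp add: Aut_add gA pr_add)
  also have "\<dots> = pr 1 c"
    unfolding comp using finite_pr[of c] by (cases "pr 1 c = 0") simp_all
  finally have "pr 1 (g c) = pr 1 z"
    by (simp add: c_def pr_diff pr_omega)
  moreover have "g z = g \<omega> + g c"
    using gA by (simp add: c_def Aut_diff)
  moreover have "g z = f \<omega>"
    using f'(2) by (simp add: z_def)
  ultimately have "pr 1 z = 0"
    using g\<omega> by (simp add: a_def pr_add)
  moreover have "g = id" if "J_1 nprod gr = {0}"
  proof -
    have "a \<in> J_1 nprod gr"
      using a zero by (simp add: J_1_def)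
    then have "a = 0"
      using that by simp
    then have "scale (1 / fact j) ((nprod a 1 ^^ j) v) = (if j = 0 then v else 0)" for j v
      by (cases j) auto
    then show ?thesis
      unfolding g_def exp_map_def by (intro ext) simp
  qed
  ultimately show ?thesis
    using that[of g f'] g f' by (simp add: z_def)
qed

section \<open>The pairing of vectors of equal weight\<close>

text \<open>By simplicity the modes applied to \<open>v\<close> produce \<open>\<one>\<close>, so some \<open>a \<in> V\<^sub>m\<close> has
  \<open>a(n + m - 1)v \<noteq> 0\<close> in \<open>V\<^sub>0\<close>. For the least such \<open>m\<close>, applying \<open>L(1)\<close> to
  \<open>a(n + m - 2)v \<in> V\<^sub>1\<close> gives \<open>0 = (m - n)a(n + m - 1)v\<close>. This replaces the invariant bilinear form
  on \<open>V\<close>.\<close>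

lemma quasi_primary_pairing:
  assumes simple: "VA_simple scale nprod"
    and v: "v \<in> gr n" "v \<noteq> 0" and L1v: "nprod \<omega> 2 v = 0"
  obtains a where "a \<in> gr n" "nprod a (2 * n - 1) v \<noteq> 0"
proof -
  have ex: "\<exists>m. \<exists>a\<in>gr m. nprod a (n + m - 1) v \<noteq> 0"
  proof (rule ccontr)
    assume no: "\<not> (\<exists>m. \<exists>a\<in>gr m. nprod a (n + m - 1) v \<noteq> 0)"
    have "pr 0 (nprod a k v) = 0" for a k
    proof (induction a rule: homogeneous_induct)
      case (1 m a)
      then have "nprod a k v \<in> gr (m + n - k - 1)"
        using v(1) by (rule nprod_gr)
      then show ?case
        using no 1 by (cases "k = n + m - 1") (auto simp: pr_same)
    qed (simp add: nprod_add_left pr_add)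
    then have "span {nprod a k v |a k. True} \<subseteq> {x. pr 0 x = 0}"
      by (intro span_minimal) (auto simp: subspace_def pr_add pr_scale)
    moreover have "span {nprod a k v |a k. True} = UNIV"
    proof -
      have "nprod vac (-1) v \<in> span {nprod a k v |a k. True}"
        by (rule span_base) blast
      then have "span {nprod a k v |a k. True} \<noteq> {0}"
        using v(2) by (auto simp: vacuum)
      then show ?thesis
        using simple modes_span_ideal[of v] unfolding VA_simple_def by blast
    qed
    ultimately have "pr 0 vac = 0"
      by blast
    then have "vac = 0"
      using pr_same[OF vac_gr, of 0] by simp
    then show False
      using v(2) vacuum[of "-1" v] by simp
  qed
  define P where "P = (\<lambda>m. \<exists>a\<in>gr (int m). nprod a (n + int m - 1) v \<noteq> 0)"
  obtain m0 a0 where "a0 \<in> gr m0" "nprod a0 (n + m0 - 1) v \<noteq> 0"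
    using ex by blast
  moreover from this have "m0 \<ge> 0"
    using gr_neg[of m0] by (cases "m0 < 0") auto
  ultimately have "P (nat m0)"
    by (auto simp: P_def)
  define m where "m = (LEAST m. P m)"
  have "P m"
    unfolding m_def using \<open>P (nat m0)\<close> by (rule LeastI)
  then obtain a where a: "a \<in> gr (int m)" "nprod a (n + int m - 1) v \<noteq> 0"
    by (auto simp: P_def)
  have least: "nprod b (n + (int m - 1) - 1) v = 0" if b: "b \<in> gr (int m - 1)" for b
  proof (cases "m = 0")
    case True
    then show ?thesis
      using b gr_neg[of "-1"] by simp
  next
    case False
    then have "\<not> P (m - 1)"
      unfolding m_def by (intro not_less_Least) (simp add: m_def)
    then show ?thesis
      using b False by (auto simp: P_def of_nat_diff)
  qed
  define k where "k = n + int m - 2"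
  have "nprod a k v \<in> gr 1"
    using nprod_gr[OF a(1) v(1), of k] by (simp add: k_def)
  then have "nprod \<omega> 2 (nprod a k v) = 0"
    by (rule L_1)
  moreover have "nprod (nprod \<omega> 2 a) k v = 0"
    using least[of "nprod \<omega> 2 a"] nprod_gr[OF omega_gr a(1), of 2]
    by (simp add: k_def algebra_simps)
  moreover have "nprod (nprod \<omega> 0 a) (k + 2) v = scale (- of_int (k + 2)) (nprod a (k + 1) v)"
  proof -
    have "nprod (T a) (k + 2) v = scale (- of_int (k + 2)) (nprod a (k + 2 - 1) v)"
      by (rule nprod_translation)
    also have "k + 2 - 1 = k + 1"
      by simp
    finally show ?thesis
      unfolding L_minus_1 .
  qed
  moreover have "nprod (nprod \<omega> 1 a) (k + 1) v = scale (of_int (int m)) (nprod a (k + 1) v)"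
    using L_0[OF a(1)] by (simp add: nprod_scale_left)
  ultimately have "scale (- of_int (k + 2)) (nprod a (k + 1) v) +
      scale 2 (scale (of_int (int m)) (nprod a (k + 1) v)) = 0"
    using commutator_2[of \<omega> a k v] L1v by simp
  then have "scale (of_int (int m - n)) (nprod a (k + 1) v) = 0"
  proof -
    assume "scale (- of_int (k + 2)) (nprod a (k + 1) v) +
      scale 2 (scale (of_int (int m)) (nprod a (k + 1) v)) = 0"
    then have "scale (- of_int (k + 2) + 2 * of_int (int m)) (nprod a (k + 1) v) = 0"
      by (simp only: scale_left_distrib scale_scale)
    moreover have "- of_int (k + 2) + 2 * of_int (int m) = (of_int (int m - n) :: 'k)"
      by (simp add: k_def)
    ultimately show ?thesis
      by (simp only:)
  qed
  moreover have "nprod a (k + 1) v \<noteq> 0"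
    using a(2) by (simp add: k_def algebra_simps)
  ultimately have "of_int (int m - n) = (0 :: 'k)"
    by (metis scale_eq_0_iff)
  then have "int m = n"
    unfolding of_int_eq_0_iff by simp
  then show ?thesis
    using that a by simp
qed

end

section \<open>Automorphisms with no component of weight one preserve the filtration\<close>

lemma (in vector_space) surj_imp_inj_finite_span:
  assumes X: "Vector_Spaces.linear scale scale X"
    and B: "finite B" "W \<subseteq> span B" and surj: "X ` W = W"
    and v: "v \<in> W" "X v = 0"
  shows "v = 0"
proof (rule ccontr)
  assume "v \<noteq> 0"
  then have "independent {v}"
    by (simp add: dependent_single)
  then obtain C where C: "{v} \<subseteq> C" "C \<subseteq> W" "independent C" "W \<subseteq> span C"
    using maximal_independent_subset_extend[of "{v}" W] v(1) by auto
  have fin: "finite C"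
    using independent_span_bound[OF B(1) C(3)] C(2) B(2) by blast
  have "X ` C \<subseteq> span (X ` (C - {v}))"
  proof
    fix y assume "y \<in> X ` C"
    then obtain x where "x \<in> C" "y = X x"
      by blast
    then show "y \<in> span (X ` (C - {v}))"
      using v(2) by (cases "x = v") (simp add: span_zero, intro span_base, simp)
  qed
  then have "span (X ` C) \<subseteq> span (X ` (C - {v}))"
    by (rule span_minimal) (rule subspace_span)
  moreover have "X ` span C = span (X ` C)"
    using module_hom.span_image[of scale scale X C] X by (simp add: linear_iff_module_hom)
  ultimately have "X ` W \<subseteq> span (X ` (C - {v}))"
    using image_mono[OF C(4), of X] by simp
  then have "C \<subseteq> span (X ` (C - {v}))"
    using C(2) surj by simp
  then have "card C \<le> card (X ` (C - {v}))"
    using independent_span_bound[of "X ` (C - {v})" C] fin C(3) by simp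
  also have "\<dots> \<le> card (C - {v})"
    using fin by (intro card_image_le) simp
  also have "\<dots> < card C"
    using fin C(1) by (intro psubset_card_mono) auto
  finally show False
    by simp
qed

context strong_CFT_type_VOA
begin

text \<open>\<open>f L(0) f\<inverse> = (f \<omega>)(1)\<close> acts on the quotient \<open>upper n / upper (n + 1)\<close>, which is \<open>V\<^sub>n\<close>, as
  \<open>n + E\<close>, where \<open>E = c(1)\<close> for the component \<open>c\<close> of weight two of \<open>f \<omega> - \<omega>\<close>. If \<open>f\<close> preserves
  \<open>upper n\<close>, then \<open>V\<^sub>n\<close> is spanned by the images of the eigenspaces \<open>f(V\<^sub>m)\<close>, \<open>m \<ge> n\<close>, so that the
  derivation \<open>E\<close> is diagonalizable on \<open>V\<^sub>n\<close> with eigenvalues \<open>m - n \<ge> 0\<close>. By the pairing the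
  eigenvalues on \<open>V\<^sub>n\<close> cannot be positive once \<open>E = 0\<close> in smaller weights. So \<open>E = 0\<close> on \<open>V\<^sub>n\<close>, and
  the eigenspaces \<open>f(V\<^sub>m)\<close>, \<open>m > n\<close>, lie in \<open>upper (n + 1)\<close>.\<close>

lemma Aut_preserves_upper:
  assumes simple: "VA_simple scale nprod"
    and f: "f \<in> AUT" and w1: "pr 1 (f \<omega>) = 0"
  shows "f v \<in> upper n \<longleftrightarrow> v \<in> upper n"
proof -
  define c where "c = f \<omega> - \<omega>"
  have c_zero: "nprod (pr i c) 0 b = 0" for i b
    unfolding c_def by (rule Aut_omega_zero_mode[OF f])
  have c1: "pr 1 c = 0"
    using w1 pr_same[OF omega_gr, of 1] by (simp add: c_def pr_diff)
  have c0: "nprod (pr 0 c) 1 b = 0" for b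
    using pr_mem[of 0 c] unfolding gr_0 by (auto simp: span_singleton nprod_scale_left vacuum)
  have cneg: "pr i c = 0" if "i < 0" for i
    using pr_mem[of i c] gr_neg[OF that] by simp
  define E where "E = nprod (pr 2 c) 1"
  have E_add: "E (u + v) = E u + E v" and E_scale: "E (scale s v) = scale s (E v)" for u v s
    by (simp_all add: E_def nprod_linear)
  have E_deriv: "E (nprod a k b) = nprod (E a) k b + nprod a k (E b)" for a k b
    unfolding E_def by (rule first_mode_derivation[OF c_zero])
  have E_omega: "E \<omega> = 0"
    unfolding E_def by (rule weight_two_first_mode_omega[OF pr_mem c_zero])
  have E_gr_0: "E v = 0" if "v \<in> gr 0" for v
  proof -
    have "E vac = 0"
      by (simp add: E_def creation_nonneg)
    then show ?thesis
      using that unfolding gr_0 by (auto simp: span_singleton E_scale)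
  qed
  have E0: "E 0 = 0"
    by (simp add: E_def)
  have E_sum: "E (sum w S) = (\<Sum>i\<in>S. E (w i))" for w :: "int \<Rightarrow> 'v" and S
    using E_add by (rule additive_sum[of E])
  \<comment> \<open>Components of \<open>c\<close> of weight \<open>i > 2\<close> raise weights, the one of weight \<open>0\<close> is a multiple of
      \<open>\<one>\<close> and has no mode of index \<open>1\<close>, and the one of weight \<open>1\<close> is \<open>0\<close>.\<close>
  have lead: "pr n (nprod (f \<omega>) 1 x) = scale (of_int n) (pr n x) + E (pr n x)"
    if x: "x \<in> upper n" for x n
  proof -
    have "pr n (nprod c 1 x) = (\<Sum>i | pr i c \<noteq> 0. nprod (pr i c) 1 (pr (n - (i - 1 - 1)) x))"
      by (rule pr_nprod)
    also have "\<dots> = (\<Sum>i | pr i c \<noteq> 0. if i = 2 then E (pr n x) else 0)"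
    proof (rule sum.cong[OF refl])
      fix i assume i: "i \<in> {i. pr i c \<noteq> 0}"
      consider "i < 0" | "i = 0" | "i = 1" | "i = 2" | "i > 2"
        by linarith
      then show "nprod (pr i c) 1 (pr (n - (i - 1 - 1)) x) = (if i = 2 then E (pr n x) else 0)"
        using i x cneg[of i] c0 c1 by cases (auto simp: E_def upper_def)
    qed
    also have "\<dots> = E (pr n x)"
      using finite_pr[of c] by (cases "pr 2 c = 0") (simp_all add: E_def)
    finally have "pr n (nprod c 1 x) = E (pr n x)" .
    moreover have "nprod (f \<omega>) 1 x = nprod \<omega> 1 x + nprod c 1 x"
      by (simp add: c_def nprod_diff_left)
    ultimately show ?thesis
      by (simp add: pr_add pr_L_0)
  qed
  have f_eigen: "nprod (f \<omega>) 1 (f u) = scale (of_int m) (f u)" if "u \<in> gr m" for u m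
  proof -
    have "nprod (f \<omega>) 1 (f u) = f (nprod \<omega> 1 u)"
      by (rule Aut_nprod[OF f, symmetric])
    then show ?thesis
      using L_0[OF that] by (simp add: Aut_scale[OF f])
  qed
  have f_components: "f u = (\<Sum>m | pr m u \<noteq> 0. f (pr m u))" for u
    using Aut_add[OF f] by (rule additive_components[of f])
  define Q where "Q = (\<lambda>n. (\<forall>v. f v \<in> upper n \<longleftrightarrow> v \<in> upper n) \<and> (\<forall>k<n. \<forall>v\<in>gr k. E v = 0))"
  have step: "Q (n + 1)" if Q: "Q n" for n
  proof -
    have filt: "f v \<in> upper n \<longleftrightarrow> v \<in> upper n" for v
      using Q by (simp add: Q_def)
    have low: "E v = 0" if "k < n" "v \<in> gr k" for k v
      using Q that by (simp add: Q_def)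
    have fpr: "pr n (f (pr m u)) \<in> gr n" for m u
      by simp
    have eigen: "E (pr n (f u)) = scale (of_int (m - n)) (pr n (f u))"
      if "u \<in> gr m" "n \<le> m" for u m
    proof -
      have "f u \<in> upper n"
        using filt gr_upper[OF that(1)] upper_mono[OF that(2)] by blast
      then have "scale (of_int n) (pr n (f u)) + E (pr n (f u)) =
          scale (of_int m) (pr n (f u))"
        using lead[of "f u" n] f_eigen[OF that(1)] by (simp add: pr_scale)
      then show ?thesis
        by (simp add: scale_left_diff_distrib) (metis add_diff_cancel_left')
    qed
    have decomp: "\<exists>S W. finite S \<and> w = (\<Sum>m\<in>S. W m) \<and>
        (\<forall>m\<in>S. n \<le> m \<and> W m \<in> gr n \<and> E (W m) = scale (of_int (m - n)) (W m))"
      if w: "w \<in> gr n" for w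
    proof -
      define u where "u = inv_map f w"
      have u: "f u = w"
        using f by (simp add: u_def)
      then have "u \<in> upper n"
        using filt gr_upper[OF w] by blast
      then have ge: "n \<le> m" if "pr m u \<noteq> 0" for m
        using that by (auto simp: upper_def not_less[symmetric])
      have "w = pr n (f u)"
        using u w by (simp add: pr_same)
      also have "\<dots> = (\<Sum>m | pr m u \<noteq> 0. pr n (f (pr m u)))"
        by (subst f_components) (rule pr_sum)
      finally show ?thesis
        using finite_pr[of u] ge eigen[OF pr_mem]
        by (intro exI[of _ "{m. pr m u \<noteq> 0}"] exI[of _ "\<lambda>m. pr n (f (pr m u))"]) auto
    qed
    \<comment> \<open>\<open>L(1)w\<close> has weight \<open>n - 1\<close>, where \<open>E\<close> vanishes, while \<open>E (L(1)w) = e L(1)w\<close>;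
        so \<open>w\<close> is quasi-primary and the pairing applies.\<close>
    have no_positive: "w = 0"
      if w: "w \<in> gr n" "E w = scale (of_int e) w" and e: "e > 0" for w e
    proof (rule ccontr)
      assume "w \<noteq> 0"
      have "nprod \<omega> 2 w \<in> gr (n - 1)"
        using nprod_gr[OF omega_gr w(1), of 2] by simp
      then have "E (nprod \<omega> 2 w) = 0"
        by (intro low) auto
      then have "scale (of_int e) (nprod \<omega> 2 w) = 0"
        by (simp add: E_deriv E_omega w(2) nprod_scale_right)
      then have "nprod \<omega> 2 w = 0"
        using e by simp
      then obtain a where a: "a \<in> gr n" "nprod a (2 * n - 1) w \<noteq> 0"
        using quasi_primary_pairing[OF simple w(1) \<open>w \<noteq> 0\<close>] by blast
      obtain S A where A: "finite S" "a = (\<Sum>m\<in>S. A m)"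
        "\<And>m. m \<in> S \<Longrightarrow> n \<le> m \<and> A m \<in> gr n \<and> E (A m) = scale (of_int (m - n)) (A m)"
        using decomp[OF a(1)] by blast
      have "(\<Sum>m\<in>S. nprod (A m) (2 * n - 1) w) \<noteq> 0"
        using a(2) by (simp add: A(2) nprod_sum_left)
      then obtain m where m: "m \<in> S" "nprod (A m) (2 * n - 1) w \<noteq> 0"
        by (rule sum.not_neutral_contains_not_neutral)
      have "nprod (A m) (2 * n - 1) w \<in> gr 0"
        using nprod_gr[of "A m" n w n "2 * n - 1"] A(3)[OF m(1)] w(1) by simp
      then have "0 = E (nprod (A m) (2 * n - 1) w)"
        by (simp add: E_gr_0)
      also have "\<dots> = scale (of_int (m - n + e)) (nprod (A m) (2 * n - 1) w)"
        using A(3)[OF m(1)]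
        by (simp add: E_deriv w(2) nprod_scale_left nprod_scale_right scale_left_distrib
            del: of_int_diff)
      finally have "m - n + e = 0"
        using m(2) by (metis of_int_eq_0_iff scale_eq_0_iff)
      then show False
        using A(3)[OF m(1)] e by linarith
    qed
    have E_n: "E w = 0" if w: "w \<in> gr n" for w
    proof -
      obtain S W where W: "w = (\<Sum>m\<in>S. W m)"
        "\<And>m. m \<in> S \<Longrightarrow> n \<le> m \<and> W m \<in> gr n \<and> E (W m) = scale (of_int (m - n)) (W m)"
        using decomp[OF w] by blast
      have "E (W m) = 0" if "m \<in> S" for m
      proof (cases "m = n")
        case True
        then show ?thesis
          using W(2)[OF that] by simp
      next
        case False
        then have "W m = 0"
          using W(2)[OF that] by (intro no_positive[of _ "m - n"]) auto
        then show ?thesis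
          by (simp add: E0)
      qed
      then show ?thesis
        by (simp add: W(1) E_sum)
    qed
    \<comment> \<open>On \<open>V\<^sub>n\<close> the induced operator is now \<open>n\<close>, so an eigenvector with eigenvalue \<open>m > n\<close> has no
        component of weight \<open>n\<close>.\<close>
    have up: "f u \<in> upper (n + 1)" if u: "u \<in> upper (n + 1)" for u
    proof -
      have "f (pr m u) \<in> upper (n + 1)" if "pr m u \<noteq> 0" for m
      proof -
        have m: "n < m"
          using u that by (auto simp: upper_def not_less[symmetric])
        then have "pr m u \<in> upper n"
          using gr_upper[OF pr_mem] upper_mono[of n m] by auto
        then have "f (pr m u) \<in> upper n"
          using filt by simp
        moreover have "scale (of_int (m - n)) (pr n (f (pr m u))) = 0"
          using eigen[OF pr_mem, of m u] m E_n[OF fpr] by simp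
        ultimately show ?thesis
          using m by (intro upper_Suc) (simp_all del: of_int_diff)
      qed
      then show ?thesis
        unfolding f_components[of u] by (intro subspace_sum[OF subspace_upper]) simp
    qed
    \<comment> \<open>Conversely, \<open>f\<close> induces a surjective, hence injective endomorphism of the finite-dimensional
        quotient \<open>upper n / upper (n + 1)\<close>, which is \<open>V\<^sub>n\<close>.\<close>
    have down: "u \<in> upper (n + 1)" if fu: "f u \<in> upper (n + 1)" for u
    proof -
      have u: "u \<in> upper n"
        using fu upper_mono[of n "n + 1"] filt by auto
      have lead_f: "pr n (f x) = pr n (f (pr n x))" if "x \<in> upper n" for x
      proof -
        have "f (x - pr n x) \<in> upper (n + 1)"
          using upper_minus_pr[OF that] by (rule up)
        then have "pr n (f (x - pr n x)) = 0"
          by (simp add: upper_def)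
        then show ?thesis
          using f by (simp add: Aut_diff pr_diff)
      qed
      have surj: "(\<lambda>x. pr n (f x)) ` gr n = gr n"
      proof
        show "gr n \<subseteq> (\<lambda>x. pr n (f x)) ` gr n"
        proof
          fix w assume w: "w \<in> gr n"
          have "f (inv_map f w) = w"
            using f by simp
          moreover from this have "inv_map f w \<in> upper n"
            using filt gr_upper[OF w] by metis
          ultimately have "w = pr n (f (pr n (inv_map f w)))"
            using lead_f[of "inv_map f w"] w by (simp add: pr_same)
          then show "w \<in> (\<lambda>x. pr n (f x)) ` gr n"
            using pr_mem by blast
        qed
      qed auto
      have lin: "Vector_Spaces.linear scale scale (\<lambda>x. pr n (f x))"
        using vector_space_axioms f
        by (simp add: Vector_Spaces.linear_iff Aut_add Aut_scale pr_add pr_scale)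
      obtain B where B: "finite B" "gr n \<subseteq> span B"
        using finite_dim_gr[of n] by auto
      have "pr n (f (pr n u)) = 0"
        using lead_f[OF u] fu by (simp add: upper_def)
      then have "pr n u = 0"
        using surj_imp_inj_finite_span[OF lin B surj, of "pr n u"] by simp
      then show ?thesis
        using u by (rule upper_Suc[rotated])
    qed
    have "E v = 0" if "k < n + 1" "v \<in> gr k" for k v
      using low[of k v] E_n[of v] that by (cases "k = n") auto
    then show ?thesis
      using up down unfolding Q_def by blast
  qed
  have Q: "Q (int k)" for k
  proof (induction k)
    case 0
    have "E v = 0" if "k < 0" "v \<in> gr k" for k v
      using that gr_neg[of k] E0 by simp
    then show ?case
      by (simp add: Q_def upper_nonpos)
  next
    case (Suc k)
    then show ?case
      using step[of "int k"] by (simp add: add.commute)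
  qed
  show ?thesis
  proof (cases "n \<le> 0")
    case True
    then show ?thesis
      by (simp add: upper_nonpos)
  next
    case False
    then show ?thesis
      using Q[of "nat n"] by (simp add: Q_def)
  qed
qed

section \<open>The triangular decomposition\<close>

lemma triangular_decomposition:
  assumes simple: "VA_simple scale nprod" and f: "f \<in> AUT"
  obtains g h k where "g \<in> AutM" "h \<in> AutZ" "k \<in> AutP" "f = g \<circ> h \<circ> k"
    "J_1 nprod gr = {0} \<Longrightarrow> g = id"
proof -
  obtain g f' where g: "g \<in> AutM" "f' \<in> AUT" "f = g \<circ> f'" "pr 1 (f' \<omega>) = 0"
    "J_1 nprod gr = {0} \<Longrightarrow> g = id"
    using remove_weight_one[OF f] by metis
  obtain h k where "h \<in> AutZ" "k \<in> AutP" "f' = h \<circ> k"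
    using filtered_decomposition[OF g(2) Aut_preserves_upper[OF simple g(2,4)]] by metis
  then show ?thesis
    using that[of g h k] g by (simp add: comp_assoc)
qed

lemma Aut_eq_set_mult:
  assumes simple: "VA_simple scale nprod"
  shows "AUT = AutM <#>\<^bsub>AUTG\<^esub> AutZ <#>\<^bsub>AUTG\<^esub> AutP"
proof
  show "AUT \<subseteq> AutM <#>\<^bsub>AUTG\<^esub> AutZ <#>\<^bsub>AUTG\<^esub> AutP"
  proof
    fix f assume "f \<in> AUT"
    then obtain g h k where "g \<in> AutM" "h \<in> AutZ" "k \<in> AutP" "f = g \<circ> h \<circ> k"
      by (rule triangular_decomposition[OF simple])
    then show "f \<in> AutM <#>\<^bsub>AUTG\<^esub> AutZ <#>\<^bsub>AUTG\<^esub> AutP"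
      unfolding set_mult_def by (auto simp: Aut_group_def)
  qed
  show "AutM <#>\<^bsub>AUTG\<^esub> AutZ <#>\<^bsub>AUTG\<^esub> AutP \<subseteq> AUT"
    by (auto simp: set_mult_def Aut_group_def Aut_minus_iff Aut_zero_iff Aut_plus_iff
        intro!: Aut_comp)
qed

lemma ex1_triangular_decomposition:
  assumes simple: "VA_simple scale nprod" and f: "f \<in> AUT"
  shows "\<exists>!x \<in> AutM \<times> AutZ \<times> AutP. case x of (g, h, k) \<Rightarrow> f = g \<circ> h \<circ> k"
proof -
  obtain g h k where "g \<in> AutM" "h \<in> AutZ" "k \<in> AutP" "f = g \<circ> h \<circ> k"
    using triangular_decomposition[OF simple f] by metis
  then show ?thesis
    using triangular_decomposition_unique[of g h k] by (intro ex1I[of _ "(g, h, k)"]) auto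
qed

lemma Aut_semidirect_product:
  assumes simple: "VA_simple scale nprod" and J: "J_1 nprod gr = {0}"
  shows "conjugation_on AUTG AutP \<in> hom (AUTG\<lparr>carrier := AutZ\<rparr>) (AutoGroup (AUTG\<lparr>carrier := AutP\<rparr>))"
    and "AUTG \<cong> semidirect_product (AUTG\<lparr>carrier := AutP\<rparr>) (AUTG\<lparr>carrier := AutZ\<rparr>)
      (conjugation_on AUTG AutP)"
proof -
  interpret G: group AUTG
    by (rule group_Aut)
  have conj: "h \<otimes>\<^bsub>AUTG\<^esub> k \<otimes>\<^bsub>AUTG\<^esub> inv\<^bsub>AUTG\<^esub> h \<in> AutP" if "h \<in> AutZ" "k \<in> AutP" for h k
  proof -
    have "h \<in> AUT"
      using that by (simp add: Aut_zero_iff)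
    then show ?thesis
      using Aut_plus_conj[OF that] unfolding inv_Aut[OF \<open>h \<in> AUT\<close>] by (simp add: Aut_group_def)
  qed
  have trivial: "AutP \<inter> AutZ = {\<one>\<^bsub>AUTG\<^esub>}"
  proof -
    have "f = id" if "f \<in> AutP" "f \<in> AutZ" for f
      using triangular_decomposition_unique[OF Aut_minus_id that(2) Aut_plus_id
          Aut_minus_id _ that(1), of id] by (simp add: Aut_zero_iff Aut_id)
    moreover have "id \<in> AutP" "id \<in> AutZ"
      using Aut_plus_id by (simp_all add: Aut_zero_iff Aut_id)
    ultimately show ?thesis
      by (auto simp: Aut_group_def)
  qed
  have total: "\<exists>p\<in>AutP. \<exists>z\<in>AutZ. f = p \<otimes>\<^bsub>AUTG\<^esub> z" if "f \<in> carrier AUTG" for f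
  proof -
    have fA: "f \<in> AUT"
      using that by (simp add: Aut_group_def)
    obtain g h k where ghk: "h \<in> AutZ" "k \<in> AutP" "f = g \<circ> h \<circ> k" "J_1 nprod gr = {0} \<Longrightarrow> g = id"
      using triangular_decomposition[OF simple fA] by metis
    then have "f = (h \<circ> k \<circ> inv_map h) \<circ> h"
      using J by (simp add: comp_assoc Aut_zero_iff)
    then show ?thesis
      using Aut_plus_conj[OF ghk(1,2)] ghk(1) by (auto simp: Aut_group_def)
  qed
  note * = G.semidirect_product_iso[OF subgroup_Aut_plus subgroup_Aut_zero conj trivial total]
  show "conjugation_on AUTG AutP \<in> hom (AUTG\<lparr>carrier := AutZ\<rparr>) (AutoGroup (AUTG\<lparr>carrier := AutP\<rparr>))"
    by (rule *(1))
  show "AUTG \<cong> semidirect_product (AUTG\<lparr>carrier := AutP\<rparr>) (AUTG\<lparr>carrier := AutZ\<rparr>)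
      (conjugation_on AUTG AutP)"
    by (rule *(2))
qed

end

theorem theorem6p1:
  fixes scale :: "'k::field_char_0 \<Rightarrow> 'v::ab_group_add \<Rightarrow> 'v"
    and nprod :: "'v \<Rightarrow> int \<Rightarrow> 'v \<Rightarrow> 'v"
    and vac \<omega> :: 'v
    and gr :: "int \<Rightarrow> 'v set"
  assumes "real_or_complex_field TYPE('k)"
    and "strong_CFT_type_VOA scale nprod vac gr \<omega>"
    and "VA_simple scale nprod"
  shows "Aut scale nprod vac =
      Aut_minus scale nprod vac gr <#>\<^bsub>Aut_group scale nprod vac\<^esub>
      Aut_zero scale nprod vac gr <#>\<^bsub>Aut_group scale nprod vac\<^esub>
      Aut_plus scale nprod vac gr \<and>
    (\<forall>f \<in> Aut scale nprod vac.
      \<exists>!x \<in> Aut_minus scale nprod vac gr \<times> Aut_zero scale nprod vac gr \<times> Aut_plus scale nprod vac gr.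
        case x of (g, h, k) \<Rightarrow> f = g \<circ> h \<circ> k) \<and>
    (J_1 nprod gr = {0} \<longrightarrow>
      (let G = Aut_group scale nprod vac;
           P = G\<lparr>carrier := Aut_plus scale nprod vac gr\<rparr>;
           Z = G\<lparr>carrier := Aut_zero scale nprod vac gr\<rparr>;
           \<phi> = conjugation_on G (carrier P)
       in group G \<and> subgroup (carrier P) G \<and> subgroup (carrier Z) G \<and>
          \<phi> \<in> hom Z (AutoGroup P) \<and>
          G \<cong> semidirect_product P Z \<phi>))"
proof -
  interpret strong_CFT_type_VOA scale nprod vac gr \<omega>
    by fact
  show ?thesis
    using Aut_eq_set_mult[OF assms(3)] ex1_triangular_decomposition[OF assms(3)]
      Aut_semidirect_product[OF assms(3)] group_Aut subgroup_Aut_plus subgroup_Aut_zero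
    by (simp add: Let_def)
qed

end
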